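(* Let $\mathbf{K}$ be an algebraically closed field of arbitrary characteristic and let $I$ be an ideal of the formal power series ring $\mathbf{K}[[x,y]]$ of finite codimension. Then the Łojasiewicz exponent $\mathcal{L}_0(I)$ is a Farey number, i.e. $\mathcal{L}_0(I)$ is an integer or a rational number of the form $N+\frac{b}{a}$, where $N,a,b$ are integers such that $0<b<a<N$.
   Context: Finite codimension means $\dim_{\mathbf{K}} \mathbf{K}[[x,y]]/I<\infty$. A parametrization is a pair $\varphi(t)=(\varphi_1(t),\varphi_2(t))\in \mathbf{K}[[t]]^2\setminus\{(0,0)\}$ such that $\varphi_1(0)=\varphi_2(0)=0$. For a power series in $t$, $\mathrm{ord}$ denotes its order (with $\mathrm{ord}\,0=+\infty$), and $\mathrm{ord}\,\varphi=\inf\{\mathrm{ord}\,\varphi_1,\mathrm{ord}\,\varphi_2\}$. For $f\in\mathbf{K}[[x,y]]$, $f\circ\varphi=f(\varphi_1(t),\varphi_2(t))\in\mathbf{K}[[t]]$. Let $\Phi$ be the set of all parametrizations. The Łojasiewicz exponent of an ideal $I\subset\mathbf{K}[[x,y]]$ is $$\mathcal{L}_0(I)=\sup_{\varphi\in\Phi}\left(\inf_{f\in I}\frac{\mathrm{ord}\, (f\circ\varphi)}{\mathrm{ord}\,\varphi}\right).$$ *)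

theory Defs
  imports
    "HOL-Library.Extended_Real"
    "HOL-Computational_Algebra.Formal_Power_Series"
    "HOL-Algebra.QuotRing"
    "HOL-Algebra.Embedded_Algebras"
    "HOL-Algebra.Algebraic_Closure_Type"
begin

text \<open>
  The ring \<open>K[[x,y]]\<close> is \<open>K[[y]][[x]]\<close>, i.e. the type \<open>'a fps fps\<close>: the coefficient of
  \<open>x\<^sup>i y\<^sup>j\<close> in \<open>f\<close> is \<open>f $ i $ j\<close>.
\<close>

text \<open>
  The quotient \<open>K[[x,y]]/I\<close> is a vector space over the image of the constants. Since
  \<^const>\<open>ring.dimension\<close> does not require the scalars to form a subfield, the unit ideal, whose
  quotient is the zero ring, has codimension 0.
\<close>

definition finite_codim_ideal :: "'a::field fps fps set \<Rightarrow> bool" where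
  "finite_codim_ideal I \<longleftrightarrow>
     (let R = ring_of_type_algebra :: 'a fps fps ring in
        ideal I R \<and>
        ring.finite_dimension (R Quot I)
          (range (\<lambda>c. I +>\<^bsub>R\<^esub> fps_const (fps_const c))) (carrier (R Quot I)))"

definition fps_ord :: "'a::zero fps \<Rightarrow> enat" where
  "fps_ord f = (if f = 0 then \<infinity> else enat (subdegree f))"

definition parametrizations :: "('a::comm_ring_1 fps \<times> 'a fps) set" where
  "parametrizations =
     {(\<phi>1, \<phi>2). (\<phi>1, \<phi>2) \<noteq> (0, 0) \<and> \<phi>1 $ 0 = 0 \<and> \<phi>2 $ 0 = 0}"

definition param_ord :: "'a::zero fps \<times> 'a fps \<Rightarrow> enat" where
  "param_ord \<phi> = inf (fps_ord (fst \<phi>)) (fps_ord (snd \<phi>))"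

text \<open>
  \<open>f(\<phi>\<^sub>1(t), \<phi>\<^sub>2(t))\<close> is the formal sum of all \<open>f $ i $ j \<cdot> \<phi>\<^sub>1\<^sup>i \<phi>\<^sub>2\<^sup>j\<close>. As \<open>\<phi>\<^sub>1, \<phi>\<^sub>2\<close> have no
  constant term, only \<open>i, j \<le> n\<close> contribute to the coefficient of \<open>t\<^sup>n\<close>; the lemma below shows
  that nothing is lost.
\<close>

definition fps_subst2 ::
    "'a::comm_ring_1 fps fps \<Rightarrow> 'a fps \<times> 'a fps \<Rightarrow> 'a fps" where
  "fps_subst2 f \<phi> =
     Abs_fps (\<lambda>n. \<Sum>i\<le>n. \<Sum>j\<le>n. f $ i $ j * (fst \<phi> ^ i * snd \<phi> ^ j) $ n)"

lemma fps_power_mult_nth_eq_0: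
  fixes p q :: "'a::comm_ring_1 fps"
  assumes "p $ 0 = 0" "q $ 0 = 0" "n < i \<or> n < j"
  shows "(p ^ i * q ^ j) $ n = 0"
  unfolding fps_mult_nth
proof (intro sum.neutral ballI)
  fix k assume "k \<in> {0..n}"
  with assms show "p ^ i $ k * q ^ j $ (n - k) = 0"
    using startsby_zero_power_prefix[of p i] startsby_zero_power_prefix[of q j] by auto
qed

lemma fps_subst2_nth:
  fixes f :: "'a::comm_ring_1 fps fps"
  assumes \<phi>: "\<phi> \<in> parametrizations" and "n \<le> M" "n \<le> N"
  shows "fps_subst2 f \<phi> $ n =
     (\<Sum>i\<le>M. \<Sum>j\<le>N. fps_const (f $ i $ j) * (fst \<phi> ^ i * snd \<phi> ^ j)) $ n"
proof -
  let ?c = "\<lambda>i j. f $ i $ j * (fst \<phi> ^ i * snd \<phi> ^ j) $ n"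
  have \<phi>0: "fst \<phi> $ 0 = 0" "snd \<phi> $ 0 = 0"
    using \<phi> by (auto simp: parametrizations_def)
  have z: "?c i j = 0" if "n < i \<or> n < j" for i j
    using fps_power_mult_nth_eq_0[OF \<phi>0 that] by simp
  have "(\<Sum>i\<le>n. \<Sum>j\<le>n. ?c i j) = (\<Sum>i\<le>M. \<Sum>j\<le>n. ?c i j)"
    by (rule sum.mono_neutral_left) (use \<open>n \<le> M\<close> z in \<open>auto intro!: sum.neutral\<close>)
  also have "\<dots> = (\<Sum>i\<le>M. \<Sum>j\<le>N. ?c i j)"
    by (intro sum.cong refl sum.mono_neutral_left) (use \<open>n \<le> N\<close> z in auto)
  finally show ?thesis
    by (simp add: fps_subst2_def fps_sum_nth)
qed

definition lojasiewicz_exponent :: "'a::comm_ring_1 fps fps set \<Rightarrow> ereal" where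
  "lojasiewicz_exponent I =
     (SUP \<phi>\<in>parametrizations. INF f\<in>I.
        ereal_of_enat (fps_ord (fps_subst2 f \<phi>)) / ereal_of_enat (param_ord \<phi>))"

definition farey_number :: "real \<Rightarrow> bool" where
  "farey_number q \<longleftrightarrow> q \<in> \<int> \<or>
     (\<exists>N a b :: int. 0 < b \<and> b < a \<and> a < N \<and> q = of_int N + of_int b / of_int a)"

end

theory Submission
  imports Defs
begin

text \<open>
  For a parametrization \<open>\<phi>\<close> of order \<open>a\<close> let \<open>A\<close> be the least order of \<open>f \<circ> \<phi>\<close> with \<open>f \<in> I\<close>, so that
  \<open>\<phi>\<close> contributes the ratio \<open>A / a\<close> to the supremum. Finite codimension bounds these ratios, and a
  bounded interval contains only finitely many nonnegative Farey numbers. The theorem therefore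
  reduces to one claim: every \<open>\<phi>\<close> is dominated by some \<open>\<psi>\<close> whose ratio is at least as large and is
  a Farey number. Then the supremum is a maximum over a finite set of Farey numbers.

  The claim (\<open>farey_improvement\<close>) is proved by induction on \<open>a\<close>. If \<open>a\<close> divides \<open>A\<close>, or if
  \<open>A \<ge> a (a + 1)\<close>, then \<open>A / a\<close> is itself a Farey number. If all elements of \<open>I\<close> have order at least
  \<open>a\<close> and the ratio is not an integer, then the tangent direction of \<open>\<phi>\<close> is a zero of all forms of
  degree \<open>a\<close> in \<open>I\<close>, and the tangent line has ratio at least \<open>a + 1\<close>. There remains the case in
  which \<open>I\<close> contains an element of order less than \<open>a\<close>; here \<open>\<phi>\<close> is replaced by a parametrization
  of smaller order.

  The replacement (\<open>lower_order_parametrization\<close>) is a substitute for Puiseux expansions that works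
  in every characteristic. Let \<open>\<phi> = (\<phi>\<^sub>1, \<phi>\<^sub>2)\<close> have orders \<open>n\<close> and \<open>c\<close>, and let \<open>g = gcd n c\<close>,
  \<open>\<alpha> = n / g\<close>, \<open>\<gamma> = c / g\<close>. With \<open>\<alpha> \<delta> - \<gamma> \<beta> = 1\<close> the substitution
  \<open>x = \<xi>\<^sup>\<alpha> u\<^sup>\<beta>\<close>, \<open>y = \<xi>\<^sup>\<gamma> u\<^sup>\<delta>\<close>, \<open>u = \<mu> + \<eta>\<close> is invertible on monomials, so \<open>\<phi>\<close> lifts to a
  parametrization whose first component has order \<open>g\<close>; this performs a whole round of blow-ups at
  once. When \<open>g = 1\<close> the multiplicity of \<open>\<phi>\<close> is produced at this very stage and the curve \<open>y = 0\<close>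
  replaces \<open>\<phi>\<close>; otherwise the replacement is found upstairs and pushed down. A polynomial \<open>f\<close> either
  does not lose by the replacement or satisfies \<open>ord f(0, y) \<ge> n\<close>. After a generic linear change of
  coordinates, the second alternative cannot hold on all of an ideal that has an element of order
  less than \<open>n\<close>, and the alternative is made uniform over the ideal by adding elements.
\<close>

section \<open>Evaluating bivariate polynomials along a parametrization\<close>

lemma poly_map_poly_add:
  assumes "h 0 = 0" "\<And>a b. h (a + b) = h a + h b"
  shows "poly (map_poly h (p + q)) x = poly (map_poly h p) x + poly (map_poly h q) x"
proof -
  have "map_poly h (p + q) = map_poly h p + map_poly h q"
    using assms by (intro poly_eqI) (simp add: coeff_map_poly)
  then show ?thesis by simp
qed

lemma poly_map_poly_mult:
  fixes h :: "'b::comm_ring_1 \<Rightarrow> 'c::comm_ring_1"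
  assumes h: "h 0 = 0" "\<And>a b. h (a + b) = h a + h b" "\<And>a b. h (a * b) = h a * h b"
  shows "poly (map_poly h (p * q)) x = poly (map_poly h p) x * poly (map_poly h q) x"
proof (induction p)
  case 0
  then show ?case by simp
next
  case (pCons a p)
  have s: "map_poly h (smult a q) = smult (h a) (map_poly h q)"
    using h by (intro poly_eqI) (simp add: coeff_map_poly)
  have "poly (map_poly h (pCons a p * q)) x =
        poly (map_poly h (smult a q)) x + poly (map_poly h (pCons 0 (p * q))) x"
    by (simp add: poly_map_poly_add[of h, OF h(1,2)])
  then show ?case
    using pCons.IH h by (simp add: s map_poly_pCons algebra_simps)
qed

text \<open>
  The outer variable of a \<open>'a poly poly\<close> is \<open>x\<close> and the inner one is \<open>y\<close>, matching the convention for
  \<open>K[[x,y]]\<close>. Polynomials suffice for all comparisons of orders, since each coefficient of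
  \<open>f \<circ> \<phi>\<close> depends on a truncation of \<open>f\<close>, and finite sums make the changes of coordinates elementary.
\<close>
definition eval2 :: "'a::field poly poly \<Rightarrow> 'a fps \<Rightarrow> 'a fps \<Rightarrow> 'a fps" where
  "eval2 f \<xi> \<eta> = poly (map_poly (\<lambda>p. poly (map_poly fps_const p) \<eta>) f) \<xi>"

lemma eval2_0 [simp]: "eval2 0 \<xi> \<eta> = 0"
  by (simp add: eval2_def)

lemma eval2_add: "eval2 (f + g) \<xi> \<eta> = eval2 f \<xi> \<eta> + eval2 g \<xi> \<eta>"
  unfolding eval2_def by (intro poly_map_poly_add) simp_all

lemma eval2_mult: "eval2 (f * g) \<xi> \<eta> = eval2 f \<xi> \<eta> * eval2 g \<xi> \<eta>"
  unfolding eval2_def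
  by (intro poly_map_poly_mult) (simp_all add: poly_map_poly_add poly_map_poly_mult)

lemma eval2_pCons:
  "eval2 (pCons p f) \<xi> \<eta> = poly (map_poly fps_const p) \<eta> + \<xi> * eval2 f \<xi> \<eta>"
  by (simp add: eval2_def map_poly_pCons)

lemma eval2_const [simp]: "eval2 [:[:c:]:] \<xi> \<eta> = fps_const c"
  by (simp add: eval2_pCons map_poly_pCons)

lemma eval2_smult: "eval2 (smult [:c:] f) \<xi> \<eta> = fps_const c * eval2 f \<xi> \<eta>"
  using eval2_mult[of "[:[:c:]:]" f] by simp

lemma eval2_1 [simp]: "eval2 1 \<xi> \<eta> = 1"
  using eval2_const[of 1] by (simp add: one_pCons)

lemma eval2_x [simp]: "eval2 [:0, 1:] \<xi> \<eta> = \<xi>"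
  by (simp add: eval2_pCons one_pCons[symmetric] del: one_pCons)

lemma eval2_pCons0 [simp]: "eval2 [:[:a, b:]:] \<xi> \<eta> = fps_const a + fps_const b * \<eta>"
  by (simp add: eval2_pCons map_poly_pCons)

lemma eval2_power: "eval2 (f ^ k) \<xi> \<eta> = eval2 f \<xi> \<eta> ^ k"
  by (induction k) (simp_all add: eval2_mult)

lemma eval2_sum: "eval2 (sum f S) \<xi> \<eta> = (\<Sum>i\<in>S. eval2 (f i) \<xi> \<eta>)"
  by (induction S rule: infinite_finite_induct) (simp_all add: eval2_add)

definition supp2 :: "'a::zero poly poly \<Rightarrow> (nat \<times> nat) set" where
  "supp2 f = {(i, j). coeff (coeff f i) j \<noteq> 0}"

lemma finite_supp2: "finite (supp2 f)"
proof (rule finite_subset)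
  show "supp2 f \<subseteq> (SIGMA i:{..degree f}. {..degree (coeff f i)})"
    by (auto simp: supp2_def intro!: le_degree)
qed auto

text \<open>
  This expansion lets substitutions be checked monomial by monomial.
\<close>
lemma poly2_as_sum:
  fixes f :: "'a::field poly poly"
  shows "f = (\<Sum>(i,j)\<in>supp2 f. smult [:coeff (coeff f i) j:] ([:0, 1:] ^ i * [:[:0, 1:]:] ^ j))"
    (is "f = ?g")
proof (intro poly_eqI)
  fix a b
  have y: "([:[:0, 1:]:] :: 'a poly poly) ^ j = [:monom 1 j:]" for j
    by (induction j) (simp_all add: monom_Suc one_pCons)
  have t: "coeff (coeff (smult [:c:] ([:0, 1:] ^ i * [:[:0, 1:]:] ^ j)) a) b =
      (if (i, j) = (a, b) then c else 0)" for i j and c :: 'a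
  proof -
    have "[:0, 1:] ^ i * [:[:0, 1:]:] ^ j = monom (monom (1::'a) j) i"
      unfolding y by (simp add: monom_altdef[of _ i])
    then show ?thesis by (simp only:) (simp add: smult_monom)
  qed
  have "coeff (coeff ?g a) b = (\<Sum>ij\<in>supp2 f. if ij = (a, b) then coeff (coeff f a) b else 0)"
    unfolding coeff_sum by (intro sum.cong refl) (auto simp: t simp del: coeff_smult split: prod.splits)
  also have "\<dots> = coeff (coeff f a) b"
    using finite_supp2[of f] by (simp add: sum.delta) (simp add: supp2_def)
  finally show "coeff (coeff f a) b = coeff (coeff ?g a) b" ..
qed

lemma eval2_as_sum:
  "eval2 f \<xi> \<eta> = (\<Sum>(i,j)\<in>supp2 f. fps_const (coeff (coeff f i) j) * \<xi> ^ i * \<eta> ^ j)"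
  by (subst poly2_as_sum)
     (simp add: eval2_sum eval2_smult eval2_mult eval2_power case_prod_unfold mult_ac)

section \<open>Monomial charts\<close>

lemma pcompose_power:
  fixes p q :: "'a::comm_ring_1 poly"
  shows "pcompose (p ^ k) q = pcompose p q ^ k"
  by (induction k) (simp_all add: pcompose_mult pcompose_1)

text \<open>
  With the weights \<open>\<alpha>\<close> for \<open>x\<close> and \<open>\<gamma>\<close> for \<open>y\<close>, the number \<open>m\<close> is the weight of \<open>f\<close>: it is the power
  of the exceptional divisor \<open>\<xi> = 0\<close> that splits off. What is left over restricts to \<open>\<xi> = 0\<close> as the
  initial form \<open>Q(u)\<close> of \<open>f\<close>, in which the Bezout relation makes the exponent of \<open>u\<close> an injective
  function of the monomial, growing by one when the exponent of \<open>y\<close> grows by \<open>\<alpha>\<close>.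

  The last conclusion is the key estimate. A zero of order \<open>g\<close> of \<open>Q\<close> at \<open>\<mu> \<noteq> 0\<close> forces the exponents of
  \<open>Q\<close> to spread over at least \<open>g\<close>, in any characteristic, so the initial form contains a monomial
  divisible by \<open>y\<^bsup>\<alpha>g\<^esup>\<close>. A pure power \<open>y\<^sup>j\<close> of \<open>f\<close> cannot have smaller weight than that
  monomial, so \<open>j \<ge> \<alpha> g\<close>.
\<close>
lemma monomial_chart:
  fixes f :: "'a::field poly poly"
  assumes "f \<noteq> 0" "0 < \<alpha>" "0 < \<gamma>" and bez: "\<alpha> * \<delta> = \<gamma> * \<beta> + 1" and "\<mu> \<noteq> 0"
  obtains m f1 where
    "\<And>\<xi> \<eta>. eval2 f (\<xi> ^ \<alpha> * (fps_const \<mu> + \<eta>) ^ \<beta>) (\<xi> ^ \<gamma> * (fps_const \<mu> + \<eta>) ^ \<delta>) =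
       \<xi> ^ m * eval2 f1 \<xi> \<eta>"
    "\<And>i j. coeff (coeff f i) j \<noteq> 0 \<Longrightarrow> m \<le> \<alpha> * i + \<gamma> * j"
    "m = 0 \<Longrightarrow> coeff (coeff f 0) 0 \<noteq> 0"
    "\<And>g j. \<forall>j<g. coeff (coeff f1 0) j = 0 \<Longrightarrow> j < \<alpha> * g \<Longrightarrow> coeff (coeff f 0) j = 0"
proof -
  define c where "c i j = coeff (coeff f i) j" for i j
  define w where "w i j = \<alpha> * i + \<gamma> * j" for i j
  define e where "e i j = \<beta> * i + \<delta> * j" for i j
  define S where "S = supp2 f"
  have S: "finite S" "(i, j) \<in> S \<longleftrightarrow> c i j \<noteq> 0" for i j
    using finite_supp2[of f] by (auto simp: S_def supp2_def c_def)
  have "S \<noteq> {}"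
    using \<open>f \<noteq> 0\<close> S(2) unfolding c_def by (metis coeff_0 ex_in_conv leading_coeff_neq_0 surj_pair)
  define m where "m = Min ((\<lambda>(i,j). w i j) ` S)"
  have m_le: "m \<le> w i j" if "(i, j) \<in> S" for i j
    unfolding m_def using S(1) that by (intro Min_le) auto
  have "m \<in> (\<lambda>(i,j). w i j) ` S"
    unfolding m_def using S(1) \<open>S \<noteq> {}\<close> by (intro Min_in) auto
  then obtain i0 j0 where ij0: "(i0, j0) \<in> S" "w i0 j0 = m" by auto
  define f1 where
    "f1 = (\<Sum>(i,j)\<in>S. smult [:c i j:] ([:0, 1:] ^ (w i j - m) * [:[:\<mu>, 1:]:] ^ e i j))"
  show thesis
  proof
    fix \<xi> \<eta>
    let ?u = "fps_const \<mu> + \<eta>"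
    have "fps_const (c i j) * (\<xi> ^ \<alpha> * ?u ^ \<beta>) ^ i * (\<xi> ^ \<gamma> * ?u ^ \<delta>) ^ j =
        \<xi> ^ m * (fps_const (c i j) * \<xi> ^ (w i j - m) * ?u ^ e i j)" if "(i, j) \<in> S" for i j
    proof -
      have "\<xi> ^ w i j = \<xi> ^ m * \<xi> ^ (w i j - m)"
        using m_le[OF that] by (simp add: power_add[symmetric])
      then show ?thesis
        by (simp add: power_mult_distrib power_mult[symmetric] w_def e_def power_add mult_ac)
    qed
    then have "(\<Sum>(i,j)\<in>S. fps_const (c i j) * (\<xi> ^ \<alpha> * ?u ^ \<beta>) ^ i * (\<xi> ^ \<gamma> * ?u ^ \<delta>) ^ j) =
        (\<Sum>(i,j)\<in>S. \<xi> ^ m * (fps_const (c i j) * \<xi> ^ (w i j - m) * ?u ^ e i j))"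
      by (intro sum.cong refl) auto
    then show "eval2 f (\<xi> ^ \<alpha> * ?u ^ \<beta>) (\<xi> ^ \<gamma> * ?u ^ \<delta>) = \<xi> ^ m * eval2 f1 \<xi> \<eta>"
      unfolding eval2_as_sum[of f] f1_def S_def[symmetric] c_def[symmetric]
      by (simp add: eval2_sum eval2_smult eval2_mult eval2_power sum_distrib_left case_prod_unfold mult.assoc)
  next
    show "coeff (coeff f i) j \<noteq> 0 \<Longrightarrow> m \<le> \<alpha> * i + \<gamma> * j" for i j
      using m_le[of i j] S(2) by (simp add: c_def w_def)
  next
    show "coeff (coeff f 0) 0 \<noteq> 0" if "m = 0"
      using ij0 S(2) that \<open>0 < \<alpha>\<close> \<open>0 < \<gamma>\<close> by (auto simp: w_def c_def)
  next
    fix g j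
    assume van: "\<forall>j<g. coeff (coeff f1 0) j = 0" and j: "j < \<alpha> * g"
    \<comment> \<open>\<open>T\<close> is the edge of the Newton polygon of slope given by the weights, \<open>Q\<close> the initial
      form in the variable \<open>u\<close>.\<close>
    define T where "T = {(i,j)\<in>S. w i j = m}"
    have T: "finite T" by (rule finite_subset[OF _ S(1)]) (auto simp: T_def)
    define Q where "Q = (\<Sum>(i,j)\<in>T. monom (c i j) (e i j))"
    have expo: "\<alpha> * e i j = \<beta> * m + j" if "(i, j) \<in> T" for i j
    proof -
      have m: "m = \<alpha> * i + \<gamma> * j" using that by (auto simp: T_def w_def)
      have "\<alpha> * e i j = \<beta> * (\<alpha> * i) + (\<alpha> * \<delta>) * j" by (simp add: e_def algebra_simps)
      also have "\<dots> = \<beta> * m + j" unfolding bez m by (simp add: algebra_simps)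
      finally show ?thesis .
    qed
    have inj: "(i, j) = (i', j')" if "(i, j) \<in> T" "(i', j') \<in> T" "e i j = e i' j'" for i j i' j'
    proof -
      have "j = j'" using expo[OF that(1)] expo[OF that(2)] that(3) by simp
      moreover have "\<alpha> * i + \<gamma> * j = \<alpha> * i' + \<gamma> * j'" using that by (auto simp: T_def w_def)
      ultimately show ?thesis using \<open>0 < \<alpha>\<close> by simp
    qed
    have coeffQ: "coeff Q k = (\<Sum>(i,j)\<in>T. if e i j = k then c i j else 0)" for k
      by (simp add: Q_def coeff_sum case_prod_unfold)
    have ex: "\<exists>i j. (i, j) \<in> T \<and> e i j = k" if "coeff Q k \<noteq> 0" for k
    proof (rule ccontr)
      assume "\<not> ?thesis"
      then have "coeff Q k = 0" unfolding coeffQ by (intro sum.neutral) auto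
      with that show False by simp
    qed
    have ij0T: "(i0, j0) \<in> T" using ij0 by (simp add: T_def)
    have "coeff Q (e i0 j0) = (\<Sum>ij\<in>T. if ij = (i0, j0) then c i0 j0 else 0)"
      unfolding coeffQ
    proof (intro sum.cong refl)
      fix ij assume ij: "ij \<in> T"
      obtain i j where [simp]: "ij = (i, j)" by (cases ij)
      show "(case ij of (i, j) \<Rightarrow> if e i j = e i0 j0 then c i j else 0) = (if ij = (i0, j0) then c i0 j0 else 0)"
        using inj[of i j i0 j0] ij ij0T by auto
    qed
    also have "\<dots> = c i0 j0" using ij0T T by (simp add: sum.delta)
    finally have "coeff Q (e i0 j0) \<noteq> 0" using ij0 S(2) by simp
    then have "Q \<noteq> 0" by auto
    have "coeff f1 0 = (\<Sum>(i,j)\<in>S. if w i j = m then [:c i j:] * [:\<mu>, 1:] ^ e i j else 0)"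
    proof -
      have "coeff f1 0 = poly f1 0" by (simp add: poly_0_coeff_0)
      also have "\<dots> = (\<Sum>(i,j)\<in>S. if w i j = m then [:c i j:] * [:\<mu>, 1:] ^ e i j else 0)"
        unfolding f1_def poly_sum
        by (intro sum.cong refl) (auto simp: power_0_left dest: m_le)
      finally show ?thesis .
    qed
    also have "\<dots> = (\<Sum>(i,j)\<in>T. [:c i j:] * [:\<mu>, 1:] ^ e i j)"
      using S(1) unfolding T_def
      by (intro sum.mono_neutral_cong_right) (auto split: if_splits)
    also have "\<dots> = pcompose Q [:\<mu>, 1:]"
      by (simp add: Q_def pcompose_sum case_prod_unfold monom_altdef pcompose_smult
          pcompose_power pcompose_pCons)
    finally have F: "coeff f1 0 = pcompose Q [:\<mu>, 1:]" .
    have "monom 1 g dvd coeff f1 0" using van by (simp add: monom_1_dvd_iff')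
    then obtain G where G: "pcompose Q [:\<mu>, 1:] = monom 1 g * G" unfolding F by (elim dvdE)
    have "Q = pcompose (pcompose Q [:\<mu>, 1:]) [:-\<mu>, 1:]"
      by (simp add: pcompose_assoc[symmetric] pcompose_pCons pcompose_idR)
    also have "\<dots> = [:-\<mu>, 1:] ^ g * pcompose G [:-\<mu>, 1:]"
      unfolding G by (simp add: pcompose_mult monom_altdef pcompose_power pcompose_pCons)
    finally have "[:-\<mu>, 1:] ^ g dvd Q" by (metis dvd_triv_left)
    then have ord: "g \<le> order \<mu> Q" using \<open>Q \<noteq> 0\<close> by (simp add: order_divides)
    \<comment> \<open>Splitting off the largest power of \<open>u\<close> does not affect the order at \<open>\<mu>\<close>, which is thus at
      most the difference between the extreme exponents of \<open>Q\<close>.\<close>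
    define k where "k = (LEAST k. coeff Q k \<noteq> 0)"
    have k: "coeff Q k \<noteq> 0" unfolding k_def by (rule LeastI) fact
    have "\<forall>i<k. coeff Q i = 0" unfolding k_def using not_less_Least by blast
    then have "monom 1 k dvd Q" by (simp add: monom_1_dvd_iff')
    then obtain Q' where Q': "Q = monom 1 k * Q'" by (elim dvdE)
    have "order \<mu> (monom 1 k) = 0" using \<open>\<mu> \<noteq> 0\<close> by (intro order_0I) (simp add: poly_monom)
    then have "order \<mu> Q = order \<mu> Q'"
      using order_mult[of "monom 1 k" Q' \<mu>] \<open>Q \<noteq> 0\<close> unfolding Q' by simp
    moreover have "Q' \<noteq> 0" using Q' \<open>Q \<noteq> 0\<close> by auto
    moreover have "degree Q = k + degree Q'"
      using \<open>Q' \<noteq> 0\<close> unfolding Q' by (subst degree_mult_eq) (auto simp: degree_monom_eq)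
    ultimately have deg: "k + g \<le> degree Q" using order_degree[of Q' \<mu>] ord by simp
    obtain i1 j1 where 1: "(i1, j1) \<in> T" "e i1 j1 = k" using ex[OF k] by blast
    obtain i2 j2 where 2: "(i2, j2) \<in> T" "e i2 j2 = degree Q"
      using ex[of "degree Q"] \<open>Q \<noteq> 0\<close> by auto
    have "\<alpha> * (k + g) \<le> \<alpha> * degree Q" using deg by simp
    then have j2: "\<alpha> * g \<le> j2"
      using expo[OF 1(1)] expo[OF 2(1)] 1(2) 2(2) by (simp add: algebra_simps)
    show "coeff (coeff f 0) j = 0"
    proof (rule ccontr)
      assume "coeff (coeff f 0) j \<noteq> 0"
      then have "m \<le> \<gamma> * j" using m_le[of 0 j] S(2)[of 0 j] by (simp add: c_def w_def)
      moreover have "\<gamma> * j2 \<le> m" using 2(1) by (auto simp: T_def w_def)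
      ultimately have "\<gamma> * j2 \<le> \<gamma> * j" by (meson le_trans)
      then show False using \<open>0 < \<gamma>\<close> j j2 by simp
    qed
  qed
qed

section \<open>Replacing a curve by one of smaller order\<close>

lemma eval2_nth_0:
  assumes "\<xi> $ 0 = 0" "\<eta> $ 0 = 0"
  shows "eval2 f \<xi> \<eta> $ 0 = coeff (coeff f 0) 0"
proof -
  have "eval2 f \<xi> \<eta> $ 0 = (\<Sum>ij\<in>supp2 f. if ij = (0, 0) then coeff (coeff f 0) 0 else 0)"
    unfolding eval2_as_sum fps_sum_nth
    using assms by (intro sum.cong refl) (auto simp: fps_nth_power_0 power_0_left split: if_splits)
  also have "\<dots> = coeff (coeff f 0) 0"
    using finite_supp2[of f] by (simp add: sum.delta) (simp add: supp2_def)
  finally show ?thesis .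
qed

lemma eval2_cong_second:
  assumes "fps_X ^ B dvd \<eta> - \<eta>'"
  shows "fps_X ^ B dvd eval2 f \<xi> \<eta> - eval2 f \<xi> \<eta>'"
proof -
  have "(\<eta> - \<eta>') dvd (\<eta> ^ j - \<eta>' ^ j)" for j
    by (metis dvd_triv_left power_diff_sumr2)
  then have *: "fps_X ^ B dvd \<eta> ^ j - \<eta>' ^ j" for j
    using assms dvd_trans by blast
  have "eval2 f \<xi> \<eta> - eval2 f \<xi> \<eta>' =
      (\<Sum>(i,j)\<in>supp2 f. fps_const (coeff (coeff f i) j) * \<xi> ^ i * (\<eta> ^ j - \<eta>' ^ j))"
    by (simp add: eval2_as_sum sum_subtractf[symmetric] algebra_simps case_prod_unfold)
  also have "fps_X ^ B dvd \<dots>"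
    using * by (intro dvd_sum) auto
  finally show ?thesis .
qed

lemma eval2_x_axis:
  "eval2 f fps_X 0 $ l = coeff (coeff f l) 0"
proof -
  have "eval2 f fps_X 0 $ l = (\<Sum>ij\<in>supp2 f. if ij = (l, 0) then coeff (coeff f l) 0 else 0)"
    unfolding eval2_as_sum fps_sum_nth
    by (intro sum.cong refl) (auto simp: power_0_left fps_X_power_nth mult.assoc split: if_splits)
  also have "\<dots> = coeff (coeff f l) 0"
    using finite_supp2[of f] by (simp add: sum.delta) (simp add: supp2_def)
  finally show ?thesis .
qed

text \<open>
  Write \<open>\<phi>\<^sub>1 = t\<^bsup>\<alpha>g\<^esup> A\<close> and \<open>\<phi>\<^sub>2 = t\<^bsup>\<gamma>g\<^esup> B\<close> with units \<open>A\<close>, \<open>B\<close>. The exponents of the chart form a matrix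
  of determinant one, and its inverse gives \<open>\<xi> = \<phi>\<^sub>1\<^sup>\<delta> / \<phi>\<^sub>2\<^sup>\<beta> = t\<^sup>g A\<^sup>\<delta> / B\<^sup>\<beta>\<close> and
  \<open>u = \<phi>\<^sub>2\<^sup>\<alpha> / \<phi>\<^sub>1\<^sup>\<gamma> = B\<^sup>\<alpha> / A\<^sup>\<gamma>\<close>. No roots are extracted, which is why the characteristic does
  not matter.
\<close>
lemma monomial_chart_lift:
  fixes \<phi>1 \<phi>2 :: "'a::field fps"
  assumes nz: "\<phi>1 \<noteq> 0" "\<phi>2 \<noteq> 0"
    and n: "subdegree \<phi>1 = \<alpha> * g" and c: "subdegree \<phi>2 = \<gamma> * g"
    and bez: "\<alpha> * \<delta> = \<gamma> * \<beta> + 1"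
  obtains \<xi> \<eta> \<mu> where "\<xi> \<noteq> 0" "subdegree \<xi> = g" "\<eta> $ 0 = 0" "\<mu> \<noteq> 0"
    "\<phi>1 = \<xi> ^ \<alpha> * (fps_const \<mu> + \<eta>) ^ \<beta>" "\<phi>2 = \<xi> ^ \<gamma> * (fps_const \<mu> + \<eta>) ^ \<delta>"
proof -
  define A where "A = fps_shift (\<alpha> * g) \<phi>1"
  define B where "B = fps_shift (\<gamma> * g) \<phi>2"
  have A: "\<phi>1 = fps_X ^ (\<alpha> * g) * A" "A $ 0 \<noteq> 0"
    using subdegree_decompose[of \<phi>1] nth_subdegree_nonzero[OF nz(1)]
    by (simp_all add: A_def n mult.commute)
  have B: "\<phi>2 = fps_X ^ (\<gamma> * g) * B" "B $ 0 \<noteq> 0"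
    using subdegree_decompose[of \<phi>2] nth_subdegree_nonzero[OF nz(2)]
    by (simp_all add: B_def c mult.commute)
  have AA: "A * inverse A = 1" and BB: "B * inverse B = 1"
    using A(2) B(2) by (simp_all add: inverse_mult_eq_1')
  have cancA: "A ^ k * inverse A ^ k = 1" and cancB: "B ^ k * inverse B ^ k = 1" for k
    using AA BB by (simp_all flip: power_mult_distrib)
  define \<xi> where "\<xi> = fps_X ^ g * (A ^ \<delta> * inverse B ^ \<beta>)"
  define u where "u = B ^ \<alpha> * inverse A ^ \<gamma>"
  have u0: "u $ 0 \<noteq> 0" using A(2) B(2) by (simp add: u_def fps_nth_power_0)
  have v0: "(A ^ \<delta> * inverse B ^ \<beta>) $ 0 \<noteq> 0" using A(2) B(2) by (simp add: fps_nth_power_0)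
  show thesis
  proof
    show "\<xi> \<noteq> 0" using v0 unfolding \<xi>_def by auto
    have "A ^ \<delta> * inverse B ^ \<beta> \<noteq> 0" using v0 by force
    then show "subdegree \<xi> = g"
      unfolding \<xi>_def using v0 by (subst subdegree_mult) (simp_all add: subdegree_eq_0)
    show "(u - fps_const (u $ 0)) $ 0 = 0" by simp
    show "u $ 0 \<noteq> 0" by fact
    have [simp]: "fps_const (u $ 0) + (u - fps_const (u $ 0)) = u" by simp
    have "\<xi> ^ \<alpha> * u ^ \<beta> =
        fps_X ^ (\<alpha> * g) * (A ^ (\<alpha> * \<delta>) * inverse A ^ (\<gamma> * \<beta>)) * (B ^ (\<alpha> * \<beta>) * inverse B ^ (\<alpha> * \<beta>))"
      by (simp add: \<xi>_def u_def power_mult_distrib power_mult[symmetric] mult_ac)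
    also have "A ^ (\<alpha> * \<delta>) * inverse A ^ (\<gamma> * \<beta>) = A * (A ^ (\<gamma> * \<beta>) * inverse A ^ (\<gamma> * \<beta>))"
      by (simp add: bez mult_ac)
    finally show "\<phi>1 = \<xi> ^ \<alpha> * (fps_const (u $ 0) + (u - fps_const (u $ 0))) ^ \<beta>"
      by (simp add: cancA cancB A(1))
    have "\<xi> ^ \<gamma> * u ^ \<delta> =
        fps_X ^ (\<gamma> * g) * (B ^ (\<alpha> * \<delta>) * inverse B ^ (\<gamma> * \<beta>)) * (A ^ (\<gamma> * \<delta>) * inverse A ^ (\<gamma> * \<delta>))"
      by (simp add: \<xi>_def u_def power_mult_distrib power_mult[symmetric] mult_ac)
    also have "B ^ (\<alpha> * \<delta>) * inverse B ^ (\<gamma> * \<beta>) = B * (B ^ (\<gamma> * \<beta>) * inverse B ^ (\<gamma> * \<beta>))"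
      by (simp add: bez mult_ac)
    finally show "\<phi>2 = \<xi> ^ \<gamma> * (fps_const (u $ 0) + (u - fps_const (u $ 0))) ^ \<delta>"
      by (simp add: cancA cancB B(1))
  qed
qed

text \<open>
  Let \<open>n\<close> and \<open>n'\<close> be the orders of \<open>\<phi>1\<close> and \<open>\<psi>1\<close>. The conclusion says that for each \<open>f\<close> either
  \<open>ord f(0, y) \<ge> n\<close>, or \<open>n' \<cdot> min (ord (f \<circ> \<phi>)) B \<le> n \<cdot> ord (f \<circ> \<psi>)\<close>, phrased with coefficients so that
  infinite orders need no separate treatment. The same \<open>\<psi>\<close> serves all \<open>f\<close>.

  The cutoff \<open>B\<close> drives the induction. The chart can leave the order of the first component
  unchanged, namely if \<open>n\<close> divides the order of \<open>\<phi>2\<close>. But it splits off a factor \<open>\<xi>\<^sup>m\<close> with \<open>m \<ge> 1\<close>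
  unless \<open>f\<close> has a constant term, so upstairs the cutoff \<open>B\<close> suffices for the cutoff \<open>Suc B\<close>.
\<close>
lemma lower_order_parametrization:
  fixes \<phi>1 \<phi>2 :: "'a::field fps"
  assumes "\<phi>1 \<noteq> 0" "2 \<le> subdegree \<phi>1" "\<phi>2 $ 0 = 0"
  shows "\<exists>\<psi>1 \<psi>2. \<psi>1 \<noteq> 0 \<and> 0 < subdegree \<psi>1 \<and> subdegree \<psi>1 < subdegree \<phi>1 \<and> \<psi>2 $ 0 = 0 \<and>
    (\<forall>f. (\<forall>j<subdegree \<phi>1. coeff (coeff f 0) j = 0) \<or>
      (\<forall>l. eval2 f \<psi>1 \<psi>2 $ l \<noteq> 0 \<longrightarrow>
         subdegree \<psi>1 * B \<le> subdegree \<phi>1 * l \<or>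
         (\<exists>k. eval2 f \<phi>1 \<phi>2 $ k \<noteq> 0 \<and> subdegree \<psi>1 * k \<le> subdegree \<phi>1 * l)))"
  using assms
proof (induction B arbitrary: \<phi>1 \<phi>2)
  case 0
  then show ?case by (intro exI[of _ fps_X] exI[of _ 0]) auto
next
  case (Suc B)
  define n where "n = subdegree \<phi>1"
  note n = \<open>2 \<le> subdegree \<phi>1\<close>[folded n_def]
  \<comment> \<open>Beyond the cutoff \<open>\<phi>2\<close> is irrelevant, so if its order is large or infinite it may be replaced
    by a power of \<open>t\<close>, whose exponent is chosen coprime to \<open>n\<close> to end in the case \<open>g = 1\<close>.\<close>
  define \<phi>2' where
    "\<phi>2' = (if \<phi>2 = 0 \<or> Suc B \<le> subdegree \<phi>2 then fps_X ^ (n * Suc B + 1) else \<phi>2)"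
  have \<phi>2': "\<phi>2' \<noteq> 0" "0 < subdegree \<phi>2'"
    using \<open>\<phi>2 $ 0 = 0\<close> by (auto simp: \<phi>2'_def subdegree_eq_0_iff intro!: Nat.gr0I)
  have "fps_X ^ Suc B dvd \<phi>2 - \<phi>2'"
  proof (cases "\<phi>2 = 0 \<or> Suc B \<le> subdegree \<phi>2")
    case True
    then have "fps_X ^ Suc B dvd \<phi>2"
      by (cases "\<phi>2 = 0") (simp_all add: fps_dvd_iff fps_X_power_subdegree del: power_Suc)
    moreover have "(fps_X :: 'a fps) ^ Suc B dvd fps_X ^ (n * Suc B + 1)"
      using n by (intro le_imp_power_dvd) (cases n, auto)
    ultimately show ?thesis using True by (simp add: \<phi>2'_def dvd_diff del: power_Suc)
  qed (simp add: \<phi>2'_def)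
  then have cong: "fps_X ^ Suc B dvd eval2 f \<phi>1 \<phi>2 - eval2 f \<phi>1 \<phi>2'" for f
    by (rule eval2_cong_second)
  have transfer: "eval2 f \<phi>1 \<phi>2 $ k \<noteq> 0" if "eval2 f \<phi>1 \<phi>2' $ k \<noteq> 0" "k < Suc B" for f k
  proof -
    have "(eval2 f \<phi>1 \<phi>2 - eval2 f \<phi>1 \<phi>2') $ k = 0"
    proof -
      obtain q where "eval2 f \<phi>1 \<phi>2 - eval2 f \<phi>1 \<phi>2' = fps_X ^ Suc B * q"
        using cong[of f] by (elim dvdE)
      then show ?thesis using that(2) by (simp only: fps_X_power_mult_nth if_True)
    qed
    then show ?thesis using that(1) by simp
  qed
  define g where "g = gcd n (subdegree \<phi>2')"
  have "0 < g" using n by (simp add: g_def)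
  obtain \<alpha> where \<alpha>: "n = \<alpha> * g" unfolding g_def by (metis dvd_def gcd_dvd1 mult.commute)
  obtain \<gamma> where \<gamma>: "subdegree \<phi>2' = \<gamma> * g" unfolding g_def by (metis dvd_def gcd_dvd2 mult.commute)
  have "0 < \<alpha>" "0 < \<gamma>" using \<alpha> \<gamma> n \<phi>2' by (auto intro!: Nat.gr0I)
  obtain \<delta> \<beta> where "n * \<delta> = subdegree \<phi>2' * \<beta> + g"
    using bezout_nat[of n "subdegree \<phi>2'"] n by (auto simp: g_def)
  then have "g * (\<alpha> * \<delta>) = g * (\<gamma> * \<beta> + 1)" unfolding \<alpha> \<gamma> by (simp add: algebra_simps)
  then have bez: "\<alpha> * \<delta> = \<gamma> * \<beta> + 1" using \<open>0 < g\<close> unfolding mult_cancel1 by blast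
  obtain \<xi> \<eta> \<mu> where lift: "\<xi> \<noteq> 0" "subdegree \<xi> = g" "\<eta> $ 0 = 0" "\<mu> \<noteq> 0"
    "\<phi>1 = \<xi> ^ \<alpha> * (fps_const \<mu> + \<eta>) ^ \<beta>" "\<phi>2' = \<xi> ^ \<gamma> * (fps_const \<mu> + \<eta>) ^ \<delta>"
    by (rule monomial_chart_lift[OF \<open>\<phi>1 \<noteq> 0\<close> \<phi>2'(1) \<alpha>[unfolded n_def] \<gamma> bez])
  note chart = monomial_chart[OF _ \<open>0 < \<alpha>\<close> \<open>0 < \<gamma>\<close> bez \<open>\<mu> \<noteq> 0\<close>]
  have eval_nz: "eval2 f \<phi>1 \<phi>2' $ (m * g + subdegree (eval2 f1 \<xi> \<eta>)) \<noteq> 0"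
    if "eval2 f \<phi>1 \<phi>2' = \<xi> ^ m * eval2 f1 \<xi> \<eta>" "eval2 f1 \<xi> \<eta> \<noteq> 0" for f f1 m
  proof -
    have "subdegree (eval2 f \<phi>1 \<phi>2') = m * g + subdegree (eval2 f1 \<xi> \<eta>)" "eval2 f \<phi>1 \<phi>2' \<noteq> 0"
      using that lift(1,2) by simp_all
    then show ?thesis by (metis nth_subdegree_nonzero)
  qed
  have \<xi>0: "\<xi> $ 0 = 0" using lift(1,2) \<open>0 < g\<close> by (metis nth_less_subdegree_zero)
  show ?case
  proof (cases "g = 1")
    case True
    show ?thesis
    \<comment> \<open>The multiplicity arises here. Unless \<open>ord f(0, y) \<ge> n\<close>, the factor \<open>f1\<close> is a unit and,
      up to the cutoff, \<open>ord (f \<circ> \<phi>) = m\<close>, whereas a pure power \<open>x\<^sup>l\<close> in \<open>f\<close> has weight \<open>n l \<ge> m\<close>.\<close>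
    proof (rule exI[of _ fps_X], rule exI[of _ 0], intro conjI allI)
      fix f
      show "(\<forall>j<subdegree \<phi>1. coeff (coeff f 0) j = 0) \<or>
        (\<forall>l. eval2 f fps_X 0 $ l \<noteq> 0 \<longrightarrow>
         subdegree (fps_X :: 'a fps) * Suc B \<le> subdegree \<phi>1 * l \<or>
         (\<exists>k. eval2 f \<phi>1 \<phi>2 $ k \<noteq> 0 \<and> subdegree (fps_X :: 'a fps) * k \<le> subdegree \<phi>1 * l))"
      proof (cases "f = 0")
        case False
        obtain m f1 where c: "eval2 f \<phi>1 \<phi>2' = \<xi> ^ m * eval2 f1 \<xi> \<eta>"
          "\<And>i j. coeff (coeff f i) j \<noteq> 0 \<Longrightarrow> m \<le> \<alpha> * i + \<gamma> * j"
          "\<And>g j. \<forall>j<g. coeff (coeff f1 0) j = 0 \<Longrightarrow> j < \<alpha> * g \<Longrightarrow> coeff (coeff f 0) j = 0"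
          using chart[OF False] unfolding lift(5,6) by metis
        show ?thesis
        proof (cases "coeff (coeff f1 0) 0 = 0")
          case True
          then have "\<forall>j<subdegree \<phi>1. coeff (coeff f 0) j = 0"
            using c(3)[of g] \<alpha> \<open>g = 1\<close> by (simp add: n_def)
          then show ?thesis by blast
        next
          case False
          then have "eval2 f1 \<xi> \<eta> $ 0 \<noteq> 0" using eval2_nth_0[OF \<xi>0 lift(3)] by simp
          then have "eval2 f1 \<xi> \<eta> \<noteq> 0" "subdegree (eval2 f1 \<xi> \<eta>) = 0"
            by (auto simp: subdegree_eq_0)
          then have "eval2 f \<phi>1 \<phi>2' $ m \<noteq> 0" using eval_nz[OF c(1)] True by simp
          then have "eval2 f \<phi>1 \<phi>2 $ m \<noteq> 0 \<or> Suc B \<le> m" using transfer not_le by blast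
          moreover have "m \<le> n * l" if "eval2 f fps_X 0 $ l \<noteq> 0" for l
            using c(2)[of l 0] that \<alpha> True by (simp add: eval2_x_axis)
          ultimately show ?thesis unfolding n_def[symmetric] by fastforce
        qed
      qed auto
    qed (use n n_def in auto)
  next
    case False
    then have "2 \<le> g" using \<open>0 < g\<close> by simp
    from Suc.IH[OF lift(1) _ lift(3), unfolded lift(2), OF this]
    obtain \<chi>1 \<chi>2 where \<chi>: "\<chi>1 \<noteq> 0" "0 < subdegree \<chi>1" "subdegree \<chi>1 < g" "\<chi>2 $ 0 = 0"
      and dich: "\<And>f. (\<forall>j<g. coeff (coeff f 0) j = 0) \<or>
        (\<forall>l. eval2 f \<chi>1 \<chi>2 $ l \<noteq> 0 \<longrightarrow> subdegree \<chi>1 * B \<le> g * l \<or>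
          (\<exists>k. eval2 f \<xi> \<eta> $ k \<noteq> 0 \<and> subdegree \<chi>1 * k \<le> g * l))"
      by blast
    define h where "h = subdegree \<chi>1"
    define u where "u = fps_const \<mu> + \<chi>2"
    have u0: "u $ 0 \<noteq> 0" using lift(4) \<chi>(4) by (simp add: u_def)
    then have u: "u \<noteq> 0" "subdegree u = 0" by auto
    define \<psi>1 where "\<psi>1 = \<chi>1 ^ \<alpha> * u ^ \<beta>"
    define \<psi>2 where "\<psi>2 = \<chi>1 ^ \<gamma> * u ^ \<delta>"
    have \<psi>1: "\<psi>1 \<noteq> 0" "subdegree \<psi>1 = \<alpha> * h"
      using \<chi>(1) u by (simp_all add: \<psi>1_def h_def)
    have "\<chi>1 $ 0 = 0" using \<chi>(1,2) by (metis nth_less_subdegree_zero)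
    then have \<psi>2: "\<psi>2 $ 0 = 0" using \<open>0 < \<gamma>\<close> by (simp add: \<psi>2_def fps_nth_power_0)
    show ?thesis
    proof (rule exI[of _ \<psi>1], rule exI[of _ \<psi>2], intro conjI allI)
      show "0 < subdegree \<psi>1" "subdegree \<psi>1 < subdegree \<phi>1"
        using \<psi>1(2) \<open>0 < \<alpha>\<close> \<chi>(2,3) \<alpha> by (simp_all add: h_def n_def)
    next
      fix f
      show "(\<forall>j<subdegree \<phi>1. coeff (coeff f 0) j = 0) \<or>
        (\<forall>l. eval2 f \<psi>1 \<psi>2 $ l \<noteq> 0 \<longrightarrow>
         subdegree \<psi>1 * Suc B \<le> subdegree \<phi>1 * l \<or>
         (\<exists>k. eval2 f \<phi>1 \<phi>2 $ k \<noteq> 0 \<and> subdegree \<psi>1 * k \<le> subdegree \<phi>1 * l))"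
      proof (cases "f = 0")
        case False
        obtain m f1 where c: "eval2 f \<phi>1 \<phi>2' = \<xi> ^ m * eval2 f1 \<xi> \<eta>"
          "eval2 f \<psi>1 \<psi>2 = \<chi>1 ^ m * eval2 f1 \<chi>1 \<chi>2"
          "m = 0 \<Longrightarrow> coeff (coeff f 0) 0 \<noteq> 0"
          "\<And>g j. \<forall>j<g. coeff (coeff f1 0) j = 0 \<Longrightarrow> j < \<alpha> * g \<Longrightarrow> coeff (coeff f 0) j = 0"
          using chart[OF False] unfolding lift(5,6) \<psi>1_def \<psi>2_def u_def by metis
        have "\<phi>1 $ 0 = 0" using n n_def by (metis nth_less_subdegree_zero pos2 order_less_le_trans)
        show ?thesis
        proof (cases "\<forall>j<g. coeff (coeff f1 0) j = 0")
          case True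
          then have "\<forall>j<subdegree \<phi>1. coeff (coeff f 0) j = 0"
            using c(4)[of g] \<alpha> by (simp add: n_def)
          then show ?thesis by blast
        next
          case False
          have "subdegree \<psi>1 * Suc B \<le> n * l \<or>
              (\<exists>k. eval2 f \<phi>1 \<phi>2 $ k \<noteq> 0 \<and> subdegree \<psi>1 * k \<le> n * l)"
            if l: "eval2 f \<psi>1 \<psi>2 $ l \<noteq> 0" for l
          proof (cases "m = 0")
            case True
            then have "eval2 f \<phi>1 \<phi>2 $ 0 \<noteq> 0"
              using c(3) eval2_nth_0[OF \<open>\<phi>1 $ 0 = 0\<close> \<open>\<phi>2 $ 0 = 0\<close>] by simp
            then show ?thesis by (intro disjI2 exI[of _ 0]) simp
          next
            case False
            define l1 where "l1 = subdegree (eval2 f1 \<chi>1 \<chi>2)"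
            have nz: "eval2 f1 \<chi>1 \<chi>2 \<noteq> 0" using l c(2) by auto
            then have "eval2 f1 \<chi>1 \<chi>2 $ l1 \<noteq> 0" by (simp add: l1_def)
            have "m * h + l1 = subdegree (eval2 f \<psi>1 \<psi>2)"
              using \<chi>(1) nz by (simp add: c(2) h_def l1_def)
            also have "\<dots> \<le> l" using l by (rule subdegree_leI)
            finally have l_ge: "m * h + l1 \<le> l" .
            have n_l: "\<alpha> * (g * (m * h + l1)) \<le> n * l"
              using l_ge unfolding \<alpha> mult.assoc by simp
            have "h * B \<le> g * l1 \<or> (\<exists>k. eval2 f1 \<xi> \<eta> $ k \<noteq> 0 \<and> h * k \<le> g * l1)"
              using dich[of f1] \<open>\<not> (\<forall>j<g. _ j)\<close> \<open>eval2 f1 \<chi>1 \<chi>2 $ l1 \<noteq> 0\<close> unfolding h_def by blast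
            then consider "h * B \<le> g * l1"
              | k where "eval2 f1 \<xi> \<eta> $ k \<noteq> 0" "h * k \<le> g * l1" by blast
            then show ?thesis
            proof cases
              case 1
              \<comment> \<open>The factor \<open>\<chi>1\<^sup>m\<close> contributes at least \<open>h\<close> to the order and pays for the step from
                \<open>B\<close> to \<open>Suc B\<close>.\<close>
              have hh: "h \<le> g * (m * h)" using False \<open>0 < g\<close> by (cases m; cases g) auto
              then have "h * Suc B \<le> g * (m * h + l1)" using add_mono[OF 1 hh] by (simp add: algebra_simps)
              then have "\<alpha> * (h * Suc B) \<le> n * l" using n_l by (meson le_trans mult_le_mono2)
              then have "subdegree \<psi>1 * Suc B \<le> n * l" unfolding \<psi>1(2) mult.assoc .
              then show ?thesis ..
            next
              case 2
              define k1 where "k1 = subdegree (eval2 f1 \<xi> \<eta>)"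
              have "k1 \<le> k" using 2(1) unfolding k1_def by (rule subdegree_leI)
              then have "h * k1 \<le> g * l1" using 2(2) by (meson le_trans mult_le_mono2)
              then have "h * (m * g + k1) \<le> g * (m * h + l1)" by (simp add: algebra_simps)
              then have le: "\<alpha> * (h * (m * g + k1)) \<le> n * l" using n_l by (meson le_trans mult_le_mono2)
              have "eval2 f \<phi>1 \<phi>2' $ (m * g + k1) \<noteq> 0"
                unfolding k1_def by (rule eval_nz[OF c(1)]) (use 2 in auto)
              then consider "eval2 f \<phi>1 \<phi>2 $ (m * g + k1) \<noteq> 0" | "Suc B \<le> m * g + k1"
                using transfer not_le by blast
              then show ?thesis
              proof cases
                case 1
                then show ?thesis using le by (auto simp: \<psi>1 mult.assoc)
              next
                case 2
                then have "\<alpha> * (h * Suc B) \<le> n * l" using le by (meson le_trans mult_le_mono2)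
                then have "subdegree \<psi>1 * Suc B \<le> n * l" unfolding \<psi>1(2) mult.assoc .
              then show ?thesis ..
              qed
            qed
          qed
          then show ?thesis unfolding n_def by blast
        qed
      qed auto
    qed (use \<psi>1 \<psi>2 in auto)
  qed
qed

section \<open>Orders along a parametrization\<close>

definition has_order :: "'a::comm_ring_1 fps \<times> 'a fps \<Rightarrow> nat \<Rightarrow> bool" where
  "has_order \<phi> a \<longleftrightarrow> 0 < a \<and> (\<forall>k<a. fst \<phi> $ k = 0 \<and> snd \<phi> $ k = 0) \<and>
     (fst \<phi> $ a \<noteq> 0 \<or> snd \<phi> $ a \<noteq> 0)"

lemma has_order_parametrization: "has_order \<phi> a \<Longrightarrow> \<phi> \<in> parametrizations"
  by (cases \<phi>) (auto simp: has_order_def parametrizations_def)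

lemma has_order_exists:
  assumes "\<phi> \<in> parametrizations"
  obtains a where "has_order \<phi> a"
proof -
  have ex: "\<exists>k. fst \<phi> $ k \<noteq> 0 \<or> snd \<phi> $ k \<noteq> 0"
    using assms by (auto simp: parametrizations_def fps_eq_iff)
  define a where "a = (LEAST k. fst \<phi> $ k \<noteq> 0 \<or> snd \<phi> $ k \<noteq> 0)"
  have "fst \<phi> $ a \<noteq> 0 \<or> snd \<phi> $ a \<noteq> 0"
    unfolding a_def by (rule LeastI_ex[OF ex])
  moreover have "\<forall>k<a. fst \<phi> $ k = 0 \<and> snd \<phi> $ k = 0"
    unfolding a_def using not_less_Least by blast
  moreover have "0 < a"
    using calculation(1) assms by (auto simp: parametrizations_def intro!: Nat.gr0I)
  ultimately show thesis by (intro that[of a]) (simp add: has_order_def)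
qed

lemma has_order_le:
  assumes "has_order \<phi> a" "fst \<phi> $ k \<noteq> 0 \<or> snd \<phi> $ k \<noteq> 0"
  shows "a \<le> k"
  using assms by (auto simp: has_order_def not_less[symmetric])

lemma enat_le_fps_ord_iff: "enat a \<le> fps_ord p \<longleftrightarrow> (\<forall>k<a. p $ k = 0)"
proof (cases "p = 0")
  case False
  have "a \<le> subdegree p \<longleftrightarrow> (\<forall>k<a. p $ k = 0)"
  proof
    assume "a \<le> subdegree p"
    then show "\<forall>k<a. p $ k = 0" by (intro allI impI nth_less_subdegree_zero) linarith
  next
    assume "\<forall>k<a. p $ k = 0"
    then show "a \<le> subdegree p" using False by (intro subdegree_geI) auto
  qed
  then show ?thesis using False by (simp only: fps_ord_def if_False enat_ord_simps)
qed (simp add: fps_ord_def)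

lemma fps_ord_le_enat: "p $ a \<noteq> 0 \<Longrightarrow> fps_ord p \<le> enat a"
  using subdegree_leI[of p a] by (cases "p = 0") (simp_all add: fps_ord_def)

lemma param_ord_has_order: "has_order \<phi> a \<Longrightarrow> param_ord \<phi> = enat a"
  unfolding has_order_def param_ord_def
  by (intro antisym)
     (auto simp: enat_le_fps_ord_iff intro: le_infI1 le_infI2 fps_ord_le_enat)

lemma fps_subst2_add: "fps_subst2 (f + g) \<phi> = fps_subst2 f \<phi> + fps_subst2 g \<phi>"
  by (intro fps_ext) (simp add: fps_subst2_def sum.distrib algebra_simps)

text \<open>
  The order of \<open>f \<circ> \<phi>\<close> is at least the product of the orders, and the coefficient in that degree is
  the value of the degree-\<open>d\<close> form of \<open>f\<close> at the tangent vector of \<open>\<phi>\<close>.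
\<close>
lemma fps_subst2_initial_form:
  assumes ord: "has_order \<phi> a" and van: "\<And>i j. i + j < d \<Longrightarrow> f $ i $ j = 0"
  shows "\<And>l. l < d * a \<Longrightarrow> fps_subst2 f \<phi> $ l = 0"
    and "fps_subst2 f \<phi> $ (d * a) = (\<Sum>i\<le>d. f $ i $ (d - i) * (fst \<phi> $ a) ^ i * (snd \<phi> $ a) ^ (d - i))"
proof -
  define P where "P = fps_shift a (fst \<phi>)"
  define Q where "Q = fps_shift a (snd \<phi>)"
  have "fst \<phi> = fps_X ^ a * P" "snd \<phi> = fps_X ^ a * Q"
    using ord by (auto simp: fps_eq_iff fps_X_power_mult_nth P_def Q_def has_order_def)
  then have "fst \<phi> ^ i * snd \<phi> ^ j = fps_X ^ (a * (i + j)) * (P ^ i * Q ^ j)" for i j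
    by (simp add: power_mult_distrib power_mult[symmetric] power_add algebra_simps)
  then have pw: "(fst \<phi> ^ i * snd \<phi> ^ j) $ l =
      (if l < a * (i + j) then 0 else (P ^ i * Q ^ j) $ (l - a * (i + j)))" for i j l
    by (simp add: fps_X_power_mult_nth)
  have "0 < a" using ord by (simp add: has_order_def)
  have z: "f $ i $ j * (fst \<phi> ^ i * snd \<phi> ^ j) $ l = 0" if "l < d * a" for i j l
  proof (cases "i + j < d")
    case False
    then have "d * a \<le> a * (i + j)" using mult_le_mono2[of d "i + j" a] by (simp add: mult.commute)
    with that have "l < a * (i + j)" by (rule order_less_le_trans)
    then show ?thesis using pw by simp
  qed (simp add: van)
  show "fps_subst2 f \<phi> $ l = 0" if "l < d * a" for l
    by (simp add: fps_subst2_def z[OF that])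
  have "d \<le> d * a" using \<open>0 < a\<close> by simp
  have e: "f $ i $ j * (fst \<phi> ^ i * snd \<phi> ^ j) $ (d * a) =
      (if i + j = d then f $ i $ j * ((fst \<phi> $ a) ^ i * (snd \<phi> $ a) ^ j) else 0)" for i j
  proof -
    consider "i + j < d" | "i + j = d" | "d < i + j" by linarith
    then show ?thesis
    proof cases
      case 3
      then have "d * a < a * (i + j)" using \<open>0 < a\<close> by (simp add: mult.commute)
      then show ?thesis using pw 3 by simp
    next
      case 2
      then have "(fst \<phi> ^ i * snd \<phi> ^ j) $ (d * a) = (P ^ i * Q ^ j) $ 0"
        using pw[of i j "d * a"] by (simp add: mult.commute)
      then show ?thesis using 2 by (simp add: fps_nth_power_0 P_def Q_def)
    qed (simp add: van)
  qed
  have "fps_subst2 f \<phi> $ (d * a) =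
     (\<Sum>i\<le>d*a. \<Sum>j\<le>d*a. if j = d - i \<and> i \<le> d then f $ i $ (d - i) * ((fst \<phi> $ a) ^ i * (snd \<phi> $ a) ^ (d - i)) else 0)"
    by (auto simp: fps_subst2_def e intro!: sum.cong)
  also have "\<dots> = (\<Sum>i\<le>d*a. if i \<le> d then f $ i $ (d - i) * ((fst \<phi> $ a) ^ i * (snd \<phi> $ a) ^ (d - i)) else 0)"
    using \<open>d \<le> d * a\<close> by (intro sum.cong refl) (auto simp: sum.delta intro: le_trans[OF diff_le_self])
  also have "\<dots> = (\<Sum>i\<le>d. f $ i $ (d - i) * ((fst \<phi> $ a) ^ i * (snd \<phi> $ a) ^ (d - i)))"
    using \<open>d \<le> d * a\<close> by (intro sum.mono_neutral_cong_right) auto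
  finally show "fps_subst2 f \<phi> $ (d * a) = (\<Sum>i\<le>d. f $ i $ (d - i) * (fst \<phi> $ a) ^ i * (snd \<phi> $ a) ^ (d - i))"
    by (simp add: mult.assoc)
qed

text \<open>
  The truncation of \<open>f\<close> to exponents up to \<open>M\<close>, in the coordinates \<open>x - s y\<close> and \<open>y\<close>. In these
  coordinates the restriction to the axis \<open>x - s y = 0\<close> is \<open>f(s y, y)\<close>, whose order is the order of \<open>f\<close> for
  generic \<open>s\<close>.
\<close>
definition shear :: "'a::field \<Rightarrow> nat \<Rightarrow> 'a fps fps \<Rightarrow> 'a poly poly" where
  "shear s M f = (\<Sum>i\<le>M. \<Sum>j\<le>M. smult [:f $ i $ j:] ([:[:0, s:], 1:] ^ i * [:[:0, 1:]:] ^ j))"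

lemma eval2_shear:
  assumes "\<phi> \<in> parametrizations" "k \<le> M"
  shows "eval2 (shear s M f) (fst \<phi> - fps_const s * snd \<phi>) (snd \<phi>) $ k = fps_subst2 f \<phi> $ k"
proof -
  have "eval2 [:[:0, s:], 1:] \<xi> \<eta> = \<xi> + fps_const s * \<eta>" for \<xi> \<eta>
    by (simp add: eval2_pCons map_poly_pCons one_pCons)
  then show ?thesis
    unfolding fps_subst2_nth[OF assms(1) assms(2) assms(2)] shear_def
    by (simp add: eval2_sum eval2_smult eval2_mult eval2_power)
qed

text \<open>
  The coefficient of \<open>y\<^sup>j\<close> is the value at \<open>(s, 1)\<close> of the form of degree \<open>j\<close> of \<open>f\<close>.
\<close>
lemma shear_axis_coeff:
  assumes "j \<le> M"
  shows "coeff (coeff (shear s M f) 0) j = (\<Sum>i\<le>j. f $ i $ (j - i) * s ^ i)"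
proof -
  have m: "[:0, s:] ^ i * [:0, 1:] ^ k = monom (s ^ i) (i + k)" for i k
  proof -
    have "[:0, s:] = monom s 1" by (simp add: monom_altdef)
    then have "[:0, s:] ^ i = monom (s ^ i) i" by (simp add: monom_power)
    moreover have "[:0, 1:] ^ k = monom (1::'a) k" by (simp add: monom_altdef)
    ultimately show ?thesis by (simp add: mult_monom)
  qed
  have "coeff (shear s M f) 0 = (\<Sum>i\<le>M. \<Sum>k\<le>M. smult (f $ i $ k) (monom (s ^ i) (i + k)))"
    unfolding poly_0_coeff_0[symmetric] shear_def by (simp add: poly_sum m)
  then have "coeff (coeff (shear s M f) 0) j =
      (\<Sum>i\<le>M. \<Sum>k\<le>M. if k = j - i \<and> i \<le> j then f $ i $ (j - i) * s ^ i else 0)"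
    by (auto simp: coeff_sum smult_monom intro!: sum.cong)
  also have "\<dots> = (\<Sum>i\<le>M. if i \<le> j then f $ i $ (j - i) * s ^ i else 0)"
    using assms by (intro sum.cong refl) (auto simp: sum.delta)
  also have "\<dots> = (\<Sum>i\<le>j. f $ i $ (j - i) * s ^ i)"
    using assms by (intro sum.mono_neutral_cong_right) auto
  finally show ?thesis .
qed

definition ideal_order :: "'a::comm_ring_1 fps fps set \<Rightarrow> 'a fps \<times> 'a fps \<Rightarrow> nat \<Rightarrow> bool" where
  "ideal_order I \<phi> A \<longleftrightarrow>
     (\<forall>f\<in>I. \<forall>l<A. fps_subst2 f \<phi> $ l = 0) \<and> (\<exists>f\<in>I. fps_subst2 f \<phi> $ A \<noteq> 0)"

lemma ideal_order_exists:
  assumes "f \<in> I" "fps_subst2 f \<phi> $ l \<noteq> 0"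
  obtains A where "ideal_order I \<phi> A"
proof -
  define A where "A = (LEAST l. \<exists>f\<in>I. fps_subst2 f \<phi> $ l \<noteq> 0)"
  have l: "\<exists>f\<in>I. fps_subst2 f \<phi> $ l \<noteq> 0" using assms by blast
  have "\<exists>f\<in>I. fps_subst2 f \<phi> $ A \<noteq> 0" unfolding A_def by (rule LeastI) (rule l)
  moreover have "\<forall>f\<in>I. \<forall>l<A. fps_subst2 f \<phi> $ l = 0"
    unfolding A_def using not_less_Least by blast
  ultimately show thesis by (intro that[of A]) (simp add: ideal_order_def)
qed

section \<open>Improving a parametrization to a Farey ratio\<close>

lemma farey_number_quotient:
  assumes "0 < a" "a dvd A \<or> a * (a + 1) \<le> A"
  shows "farey_number (real A / real a)"
proof (cases "a dvd A")
  case True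
  then obtain k where "A = a * k" ..
  then have "real A / real a = real k" using \<open>0 < a\<close> by simp
  then show ?thesis by (simp add: farey_number_def)
next
  case False
  define N b where "N = A div a" and "b = A mod a"
  have "real A / real a = real N + real b / real a"
    unfolding N_def b_def by (rule of_nat_of_nat_div_aux)
  then have "real A / real a = of_int (int N) + of_int (int b) / of_int (int a)"
    unfolding of_int_of_nat_eq .
  moreover have "0 < b" "b < a" using False \<open>0 < a\<close> by (auto simp: dvd_eq_mod_eq_0 b_def)
  moreover have "a < N"
    using assms False less_eq_div_iff_mult_less_eq[of a "a + 1" A] by (auto simp: N_def mult.commute)
  ultimately have "0 < int b \<and> int b < int a \<and> int a < int N \<and>
      real A / real a = of_int (int N) + of_int (int b) / of_int (int a)"
    by (intro conjI) (simp_all only: of_nat_less_iff of_nat_0_less_iff)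
  then show ?thesis
    unfolding farey_number_def
    by (intro disjI2) (rule exI[of _ "int N"], rule exI[of _ "int a"], rule exI[of _ "int b"])
qed

text \<open>
  Both conditions exclude only finitely many \<open>s\<close>: the first keeps the order of the first component of
  a parametrization with tangent vector \<open>(u, v)\<close> under the change of coordinates, the second makes
  the axis \<open>x = s y\<close> transversal to a curve with initial form \<open>\<Sum> c\<^sub>i x\<^sup>i y\<^bsup>d-i\<^esup>\<close>.
\<close>
lemma generic_shear:
  fixes u v :: "'a::field"
  assumes inf: "infinite (UNIV :: 'a set)" and uv: "u \<noteq> 0 \<or> v \<noteq> 0" and c: "c k \<noteq> 0" "k \<le> d"
  obtains s where "u - s * v \<noteq> 0" "(\<Sum>i\<le>d. c i * s ^ i) \<noteq> 0"
proof -
  define p where "p = (\<Sum>i\<le>d. monom (c i) i)"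
  have "coeff p k = c k" using c(2) by (simp add: p_def coeff_sum)
  then have "p \<noteq> 0" using c(1) by auto
  have "finite {s. u - s * v = 0}"
  proof (cases "v = 0")
    case False
    then have "{s. u - s * v = 0} \<subseteq> {u / v}" by (auto simp: field_simps)
    then show ?thesis by (rule finite_subset) simp
  qed (use uv in simp)
  then have "finite ({s. u - s * v = 0} \<union> {s. poly p s = 0})"
    using poly_roots_finite[OF \<open>p \<noteq> 0\<close>] by blast
  then obtain s where "s \<notin> {s. u - s * v = 0} \<union> {s. poly p s = 0}"
    using inf ex_new_if_finite by blast
  then show thesis by (intro that[of s]) (auto simp: p_def poly_sum poly_monom)
qed

text \<open>
  Induction on the order \<open>a\<close> of \<open>\<phi>\<close>, along the three cases described at the beginning. In the last
  case the replacement \<open>\<psi>\<close> of smaller order has a ratio that is at least as large. Indeed, suppose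
  that \<open>f\<^sub>0 \<in> I\<close> realizes a smaller ratio on \<open>\<psi>\<close>. Then \<open>f\<^sub>0\<close> falls under the alternative
  \<open>ord f\<^sub>0(s y, y) \<ge> a\<close>, while the element \<open>g\<close> of order less than \<open>a\<close> does not; hence \<open>g \<circ> \<psi>\<close> has a zero
  coefficient where \<open>f\<^sub>0 \<circ> \<psi>\<close> has a nonzero one, and \<open>f\<^sub>0 + g\<close> violates both alternatives.
\<close>
lemma farey_improvement:
  fixes I :: "'a::field fps fps set"
  assumes inf: "infinite (UNIV :: 'a set)"
    and add: "\<And>f g. f \<in> I \<Longrightarrow> g \<in> I \<Longrightarrow> f + g \<in> I"
    and fin: "\<And>\<phi>. \<phi> \<in> parametrizations \<Longrightarrow> \<exists>f\<in>I. \<exists>l. fps_subst2 f \<phi> $ l \<noteq> 0"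
    and "has_order \<phi> a" "ideal_order I \<phi> A"
  shows "\<exists>\<psi> b B. has_order \<psi> b \<and> ideal_order I \<psi> B \<and>
           farey_number (real B / real b) \<and> real A / real a \<le> real B / real b"
  using assms(4,5)
proof (induction a arbitrary: \<phi> A rule: less_induct)
  case (less a)
  note ord = less.prems(1) and ideal_ord = less.prems(2)
  have "0 < a" using ord by (simp add: has_order_def)
  define u where "u = fst \<phi> $ a"
  define v where "v = snd \<phi> $ a"
  have uv: "u \<noteq> 0 \<or> v \<noteq> 0" using ord by (simp add: has_order_def u_def v_def)
  show ?case
  proof (cases "a dvd A \<or> a * (a + 1) \<le> A")
    case True
    then show ?thesis using farey_number_quotient[OF \<open>0 < a\<close>] ord ideal_ord by blast
  next
    case notF: False
    show ?thesis
    proof (cases "\<forall>g\<in>I. \<forall>i j. i + j < a \<longrightarrow> g $ i $ j = 0")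
      case True
      \<comment> \<open>the tangent line of \<open>\<phi>\<close>\<close>
      define \<psi> where "\<psi> = (fps_const u * fps_X, fps_const v * fps_X)"
      have \<psi>: "has_order \<psi> 1" using uv by (auto simp: has_order_def \<psi>_def)
      obtain f0 where f0: "f0 \<in> I" "fps_subst2 f0 \<phi> $ A \<noteq> 0"
        using ideal_ord by (auto simp: ideal_order_def)
      then have "a * a \<le> A"
        using fps_subst2_initial_form(1)[OF ord, of a f0 A] True by (meson not_le)
      then have "a * a < A" using notF by (metis dvd_triv_left le_neq_implies_less)
      have van: "fps_subst2 g \<psi> $ l = 0" if "g \<in> I" "l < a + 1" for g l
      proof (cases "l < a")
        case True
        then show ?thesis
          using fps_subst2_initial_form(1)[OF \<psi>, of a g l] that
            \<open>\<forall>g\<in>I. _ g\<close> by simp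
      next
        case False
        then have "l = a" using that by simp
        have "fps_subst2 g \<psi> $ (a * 1) = fps_subst2 g \<phi> $ (a * a)"
          using fps_subst2_initial_form(2)[OF \<psi>, of a g] fps_subst2_initial_form(2)[OF ord, of a g]
            \<open>g \<in> I\<close> \<open>\<forall>g\<in>I. _ g\<close> by (simp add: \<psi>_def u_def v_def)
        also have "\<dots> = 0"
          using ideal_ord \<open>a * a < A\<close> \<open>g \<in> I\<close> by (simp add: ideal_order_def)
        finally show ?thesis by (simp add: \<open>l = a\<close>)
      qed
      obtain B where B: "ideal_order I \<psi> B"
        using fin[OF has_order_parametrization[OF \<psi>]] ideal_order_exists by metis
      then have "a + 1 \<le> B"
        using van unfolding ideal_order_def by (meson not_le)
      moreover have "real A / real a \<le> real (a + 1)"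
      proof -
        have "real A \<le> real (a * (a + 1))" using notF by (intro of_nat_mono) simp
        then show ?thesis using \<open>0 < a\<close> by (simp add: field_simps)
      qed
      ultimately have "real A / real a \<le> real B / real 1" by simp
      moreover have "farey_number (real B / real 1)"
        by (rule farey_number_quotient) auto
      ultimately show ?thesis using \<psi> B by blast
    next
      case False
      then obtain g i0 j0 where g: "g \<in> I" "i0 + j0 < a" "g $ i0 $ j0 \<noteq> 0" by auto
      define d where "d = i0 + j0"
      have "a \<noteq> 1" using notF by auto
      obtain s where s: "u - s * v \<noteq> 0" "(\<Sum>i\<le>d. g $ i $ (d - i) * s ^ i) \<noteq> 0"
        using generic_shear[OF inf uv, of "\<lambda>i. g $ i $ (d - i)" i0 d] g by (auto simp: d_def)
      define \<phi>1 where "\<phi>1 = fst \<phi> - fps_const s * snd \<phi>"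
      have "\<phi>1 $ a \<noteq> 0" using s(1) by (simp add: \<phi>1_def u_def v_def)
      then have \<phi>1: "\<phi>1 \<noteq> 0" by auto
      have sub: "subdegree \<phi>1 = a"
        by (rule subdegreeI) (use \<open>\<phi>1 $ a \<noteq> 0\<close> ord in \<open>auto simp: \<phi>1_def has_order_def\<close>)
      have "2 \<le> subdegree \<phi>1" using sub \<open>0 < a\<close> \<open>a \<noteq> 1\<close> by simp
      moreover have "snd \<phi> $ 0 = 0" using ord by (simp add: has_order_def)
      ultimately obtain \<psi>1 \<psi>2 where \<psi>12: "\<psi>1 \<noteq> 0" "0 < subdegree \<psi>1" "subdegree \<psi>1 < a" "\<psi>2 $ 0 = 0"
        and dich: "\<And>f. (\<forall>j<a. coeff (coeff f 0) j = 0) \<or>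
          (\<forall>l. eval2 f \<psi>1 \<psi>2 $ l \<noteq> 0 \<longrightarrow> subdegree \<psi>1 * A \<le> a * l \<or>
            (\<exists>k. eval2 f \<phi>1 (snd \<phi>) $ k \<noteq> 0 \<and> subdegree \<psi>1 * k \<le> a * l))"
        using lower_order_parametrization[OF \<phi>1, of "snd \<phi>" A] unfolding sub by blast
      define n where "n = subdegree \<psi>1"
      define \<psi> where "\<psi> = (\<psi>1 + fps_const s * \<psi>2, \<psi>2)"
      have "\<psi>1 $ n \<noteq> 0" using \<psi>12(1) by (simp add: n_def)
      have "\<psi>1 $ 0 = 0" using \<psi>12(1,2) by (metis nth_less_subdegree_zero)
      then have par: "\<psi> \<in> parametrizations"
        using \<psi>12 by (auto simp: parametrizations_def \<psi>_def)
      obtain b where b: "has_order \<psi> b" using has_order_exists[OF par] .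
      have "b \<le> n"
        by (rule has_order_le[OF b]) (use \<open>\<psi>1 $ n \<noteq> 0\<close> in \<open>auto simp: \<psi>_def\<close>)
      have "0 < b" using b by (simp add: has_order_def)
      obtain B where B: "ideal_order I \<psi> B"
        using fin[OF par] ideal_order_exists by metis
      \<comment> \<open>The truncation must show the coefficients of \<open>f \<circ> \<psi>\<close> up to \<open>B\<close>, those of \<open>f \<circ> \<phi>\<close> up to
        \<open>a B\<close>, and those of \<open>f(s y, y)\<close> below \<open>a\<close>.\<close>
      define M where "M = a * B + a"
      have "B \<le> M" "a \<le> M" using \<open>0 < a\<close> by (cases a; simp add: M_def)+
      have key: "n * A \<le> a * B"
      proof (rule ccontr)
        assume neg: "\<not> n * A \<le> a * B"
        define good where "good f \<longleftrightarrow> (\<forall>j<a. (\<Sum>i\<le>j. f $ i $ (j - i) * s ^ i) = 0)" for f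
        have good: "good f" if "f \<in> I" "fps_subst2 f \<psi> $ B \<noteq> 0" for f
        proof -
          have "eval2 (shear s M f) \<psi>1 \<psi>2 $ B = fps_subst2 f \<psi> $ B"
            using eval2_shear[OF par \<open>B \<le> M\<close>, of s f] by (simp add: \<psi>_def)
          moreover have "A \<le> k" if "eval2 (shear s M f) \<phi>1 (snd \<phi>) $ k \<noteq> 0" "n * k \<le> a * B" for k
          proof -
            have "k \<le> n * k" using \<psi>12(2) by (simp add: n_def)
            then have "k \<le> a * B" using that(2) by (rule le_trans)
            then have "k \<le> M" by (simp add: M_def)
            then have "fps_subst2 f \<phi> $ k \<noteq> 0"
              using eval2_shear[OF has_order_parametrization[OF ord] \<open>k \<le> M\<close>, of s f] that(1)
              by (simp add: \<phi>1_def)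
            then show ?thesis using ideal_ord \<open>f \<in> I\<close> unfolding ideal_order_def by (meson not_le)
          qed
          moreover have "n * A \<le> n * k" if "A \<le> k" for k using that by simp
          ultimately have "\<forall>j<a. coeff (coeff (shear s M f) 0) j = 0"
            using dich[of "shear s M f"] neg that(2) unfolding n_def[symmetric] by (metis le_trans)
          then show ?thesis using \<open>a \<le> M\<close> by (simp add: good_def shear_axis_coeff)
        qed
        obtain f0 where f0: "f0 \<in> I" "fps_subst2 f0 \<psi> $ B \<noteq> 0"
          using B by (auto simp: ideal_order_def)
        have "\<not> good g" using s(2) g(2) by (auto simp: good_def d_def)
        then have "fps_subst2 g \<psi> $ B = 0" using good g(1) by blast
        then have "good (f0 + g)" using f0 g(1) add by (intro good) (simp_all add: fps_subst2_add)
        moreover have "good f0" using f0 by (rule good)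
        ultimately have "good g" by (auto simp: good_def sum.distrib algebra_simps)
        with \<open>\<not> good g\<close> show False ..
      qed
      have "real A / real a \<le> real B / real n"
      proof -
        have "real (n * A) \<le> real (a * B)" using key by (rule of_nat_mono)
        then show ?thesis using \<open>0 < a\<close> \<psi>12(2) by (simp add: n_def field_simps)
      qed
      also have "\<dots> \<le> real B / real b"
        using \<open>b \<le> n\<close> \<open>0 < b\<close> by (intro divide_left_mono) auto
      finally have le: "real A / real a \<le> real B / real b" .
      have "b < a" using \<open>b \<le> n\<close> \<psi>12(3) by (simp add: n_def)
      from less.IH[OF this b B] show ?thesis using le by (meson order_trans)
    qed
  qed
qed

section \<open>Ideals of finite codimension\<close>

lemma infinite_UNIV_alg_closed_field: "infinite (UNIV :: 'a::alg_closed_field set)"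
proof
  assume fin: "finite (UNIV :: 'a set)"
  define q where "q = (\<Prod>c\<in>(UNIV :: 'a set). [:-c, 1:])"
  have "degree q = card (UNIV :: 'a set)"
    unfolding q_def by (subst degree_prod_eq_sum_degree) auto
  moreover have "card (UNIV :: 'a set) > 0" using fin by (simp add: card_gt_0_iff)
  ultimately have "degree (q + 1) > 0" by (simp add: degree_add_eq_left)
  then obtain x where "poly (q + 1) x = 0" using alg_closed_imp_poly_has_root by blast
  moreover have "poly q x = 0"
    using fin by (auto simp: q_def poly_prod intro!: prod_zero)
  ultimately show False by simp
qed

lemma ring_of_type_algebra_simps:
  defines "R \<equiv> (ring_of_type_algebra :: 'b::comm_ring_1 ring)"
  shows "carrier R = UNIV" "monoid.mult R = (*)" "ring.add R = (+)"
    "monoid.one R = 1" "ring.zero R = 0"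
  by (simp_all add: R_def ring_of_type_algebra_def)

lemma combine_ring_of_type_algebra:
  "ring.combine (ring_of_type_algebra :: 'b::comm_ring_1 ring) Ks Us = sum_list (map2 (*) Ks Us)"
proof -
  interpret ring "ring_of_type_algebra :: 'b ring" by (rule ring_from_type_algebra)
  show ?thesis
    by (induction Ks Us rule: combine.induct) (simp_all add: ring_of_type_algebra_simps)
qed

text \<open>
  The powers of \<open>z\<close> are linearly dependent modulo \<open>I\<close>. If \<open>I\<close> is the unit ideal, the image of \<open>K\<close> in the
  zero ring is not a field and \<open>1 \<in> I\<close> is the relation.
\<close>
lemma finite_codim_power_relation:
  fixes I :: "'a::field fps fps set"
  assumes "finite_codim_ideal I"
  obtains n c where "\<exists>i\<le>n. c i \<noteq> 0" "(\<Sum>i\<le>n. fps_const (fps_const (c i)) * z ^ i) \<in> I"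
proof -
  define R where "R = (ring_of_type_algebra :: 'a fps fps ring)"
  define F where "F = (ring_of_type_algebra :: 'a ring)"
  define C :: "'a \<Rightarrow> 'a fps fps" where "C c = fps_const (fps_const c)" for c
  have [simp]: "C 0 = 0" by (simp add: C_def)
  note R = ring_of_type_algebra_simps[where ?'b = "'a fps fps", folded R_def]
  note F = ring_of_type_algebra_simps[where ?'b = 'a, folded F_def]
  define Q where "Q = R Quot I"
  define h where "h = (\<lambda>x. I +>\<^bsub>R\<^esub> x)"
  from assms have I: "ideal I R"
    and "ring.finite_dimension Q (range (\<lambda>c. h (C c))) (carrier Q)"
    by (simp_all add: finite_codim_ideal_def Let_def R_def Q_def h_def C_def)
  interpret I: ideal I R by (rule I)
  interpret h: ring_hom_ring R Q h
    unfolding Q_def h_def by (rule I.rcos_ring_hom_ring)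
  have "(\<lambda>c. C c) \<in> ring_hom F R"
    by (intro ring_hom_memI) (simp_all add: R F C_def)
  moreover have "h \<in> ring_hom R Q" by (rule h.homh)
  ultimately have "h \<circ> (\<lambda>c. C c) \<in> ring_hom F Q" by (rule ring_hom_trans)
  then interpret hC: ring_hom_ring F Q "\<lambda>c. h (C c)"
    unfolding F_def by (intro ring_hom_ringI2) (auto simp: comp_def intro: h.S.ring_axioms)
  obtain n where dim: "h.S.dimension n (range (\<lambda>c. h (C c))) (carrier Q)"
    using \<open>ring.finite_dimension Q _ _\<close> by (auto simp: h.S.finite_dimension_def)
  have in_I: "r \<in> I" if "h r = \<zero>\<^bsub>Q\<^esub>" for r
  proof -
    have "\<zero>\<^bsub>Q\<^esub> = I" by (simp add: Q_def FactRing_def)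
    moreover have "r \<in> h r" unfolding h_def by (rule I.a_rcos_self) (simp add: R)
    ultimately show ?thesis using that by simp
  qed
  show thesis
  proof (cases "\<one>\<^bsub>Q\<^esub> = \<zero>\<^bsub>Q\<^esub>")
    case True
    then have "1 \<in> I" using in_I[of 1] h.hom_one by (simp add: R)
    then show thesis by (intro that[of 0 "\<lambda>_. 1"]) auto
  next
    case False
    interpret F: field F unfolding F_def by (rule field_from_type_algebra)
    have sub: "subfield (range (\<lambda>c. h (C c))) Q"
      using hC.img_is_subfield(2)[OF F.carrier_is_subfield False] by (simp add: F)
    define zs where "zs = map (\<lambda>i. z ^ i) [0..<Suc n]"
    have carr: "set (map h zs) \<subseteq> carrier Q" using h.hom_closed by (auto simp: R)
    have "\<not> h.S.independent (range (\<lambda>c. h (C c))) (map h zs)"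
      using h.S.independent_length_le_dimension[OF sub dim _ carr] by (auto simp: zs_def)
    then obtain Ks where Ks: "length Ks = length (map h zs)" "h.S.combine Ks (map h zs) = \<zero>\<^bsub>Q\<^esub>"
      "set Ks \<subseteq> range (\<lambda>c. h (C c))" "set Ks \<noteq> {\<zero>\<^bsub>Q\<^esub>}"
      using h.S.dependent_imp_non_trivial_combine[OF sub carr] by blast
    have "\<forall>k\<in>set Ks. \<exists>c. k = h (C c)" using Ks(3) by auto
    then obtain cs where cs: "Ks = map (\<lambda>c. h (C c)) cs" by (metis ex_map_conv)
    have len: "length cs = Suc n" using Ks(1) by (simp add: cs zs_def)
    have "Ks = map h (map C cs)" by (simp add: cs)
    then have "h (ring.combine R (map C cs) zs) = \<zero>\<^bsub>Q\<^esub>"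
      using Ks(2) h.combine_hom[of "map C cs" zs] by (simp add: R)
    then have "ring.combine R (map C cs) zs \<in> I" by (rule in_I)
    also have "ring.combine R (map C cs) zs = (\<Sum>i<Suc n. C (cs ! i) * z ^ i)"
      unfolding R_def combine_ring_of_type_algebra
      using len by (simp add: sum_list_sum_nth zs_def atLeast0LessThan del: upt_Suc)
    finally have "(\<Sum>i\<le>n. C (cs ! i) * z ^ i) \<in> I" by (simp add: lessThan_Suc_atMost)
    moreover have "\<exists>i\<le>n. cs ! i \<noteq> 0"
    proof (rule ccontr)
      assume "\<not> ?thesis"
      then have cs0: "cs ! i = 0" if "i < length cs" for i
        using that len by (simp add: less_Suc_eq_le)
      have "h (C 0) = \<zero>\<^bsub>Q\<^esub>" using h.hom_zero by (simp add: R)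
      then have "Ks ! i = \<zero>\<^bsub>Q\<^esub>" if "i < length Ks" for i
        using that cs0[of i] by (simp add: cs)
      then have "set Ks \<subseteq> {\<zero>\<^bsub>Q\<^esub>}"
        by (simp only: subset_iff singleton_iff Ball_def[symmetric] all_set_conv_all_nth) simp
      moreover have "set Ks \<noteq> {}" using len by (auto simp: cs)
      ultimately have "set Ks = {\<zero>\<^bsub>Q\<^esub>}" by (simp add: subset_singleton_iff)
      with Ks(4) show False ..
    qed
    ultimately show thesis by (intro that[of n "\<lambda>i. cs ! i"]) (auto simp: C_def)
  qed
qed

text \<open>
  A relation between the powers of \<open>x\<close> is a nonzero element of \<open>I\<close> in one variable. If \<open>p\<close> is its order,
  then along a parametrization of order \<open>a\<close> whose first component also has order \<open>a\<close> it has order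
  exactly \<open>p a\<close>. The same holds for \<open>y\<close> and the second component, and one of the two components always
  has order \<open>a\<close>.
\<close>
lemma finite_codim_ideal_order_bound:
  fixes I :: "'a::field fps fps set"
  assumes "finite_codim_ideal I"
  obtains k where
    "\<And>\<phi> a. has_order \<phi> a \<Longrightarrow> \<exists>f\<in>I. \<exists>l\<le>k * a. fps_subst2 f \<phi> $ l \<noteq> 0"
proof -
  obtain n c where c: "\<exists>i\<le>n. c i \<noteq> 0" "(\<Sum>i\<le>n. fps_const (fps_const (c i)) * fps_X ^ i) \<in> I"
    by (rule finite_codim_power_relation[OF assms])
  obtain m d where d: "\<exists>i\<le>m. d i \<noteq> 0" "(\<Sum>i\<le>m. fps_const (fps_const (d i)) * fps_const fps_X ^ i) \<in> I"
    by (rule finite_codim_power_relation[OF assms])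
  define f where "f = (\<Sum>i\<le>n. fps_const (fps_const (c i)) * fps_X ^ i)"
  define g where "g = (\<Sum>i\<le>m. fps_const (fps_const (d i)) * fps_const fps_X ^ i)"
  have f: "f $ i $ j = (if i \<le> n \<and> j = 0 then c i else 0)" for i j
  proof -
    have "f $ i $ j = (\<Sum>k\<le>n. if k = i then (if j = 0 then c i else 0) else 0)"
      unfolding f_def fps_sum_nth
      by (intro sum.cong refl) (auto simp: fps_X_power_nth)
    then show ?thesis by (simp add: sum.delta)
  qed
  have g: "g $ i $ j = (if j \<le> m \<and> i = 0 then d j else 0)" for i j
  proof -
    have "g $ i $ j = (\<Sum>k\<le>m. if k = j then (if i = 0 then d j else 0) else 0)"
      unfolding g_def fps_sum_nth
      by (intro sum.cong refl) (auto simp: fps_X_power_nth)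
    then show ?thesis by (simp add: sum.delta)
  qed
  have least: "\<exists>i0\<le>N. e i0 \<noteq> 0 \<and> (\<forall>i<i0. e i = 0)" if ex: "\<exists>i\<le>N. e i \<noteq> 0" for N and e :: "nat \<Rightarrow> 'a"
  proof -
    from ex obtain i where i: "i \<le> N" "e i \<noteq> 0" by (elim exE conjE)
    define i0 where "i0 = (LEAST i. e i \<noteq> 0)"
    note P = LeastI[where P = "\<lambda>i. e i \<noteq> 0", OF i(2)]
      Least_le[where P = "\<lambda>i. e i \<noteq> 0", OF i(2)]
      not_less_Least[where P = "\<lambda>i. e i \<noteq> 0"]
    show ?thesis
    proof (intro exI[of _ i0] conjI allI impI)
      show "e i0 \<noteq> 0" "i0 \<le> N" using P(1,2) i(1) by (simp_all add: i0_def)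
      show "e j = 0" if "j < i0" for j using P(3)[of j] that by (simp add: i0_def)
    qed
  qed
  obtain p where p: "p \<le> n" "c p \<noteq> 0" "\<forall>i<p. c i = 0" using least[OF c(1)] by blast
  obtain q where q: "q \<le> m" "d q \<noteq> 0" "\<forall>i<q. d i = 0" using least[OF d(1)] by blast
  show thesis
  proof
    fix \<phi> :: "'a fps \<times> 'a fps" and a
    assume ord: "has_order \<phi> a"
    show "\<exists>f\<in>I. \<exists>l\<le>(p + q) * a. fps_subst2 f \<phi> $ l \<noteq> 0"
    proof (cases "fst \<phi> $ a = 0")
      case False
      have "fps_subst2 f \<phi> $ (p * a) = (\<Sum>i\<le>p. f $ i $ (p - i) * (fst \<phi> $ a) ^ i * (snd \<phi> $ a) ^ (p - i))"
        by (rule fps_subst2_initial_form[OF ord]) (use p in \<open>auto simp: f\<close>)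
      also have "\<dots> = (\<Sum>i\<le>p. if i = p then c p * (fst \<phi> $ a) ^ p else 0)"
        using p(1) by (intro sum.cong refl) (auto simp: f)
      also have "\<dots> = c p * (fst \<phi> $ a) ^ p" by (simp add: sum.delta)
      finally have "fps_subst2 f \<phi> $ (p * a) \<noteq> 0" using False p(2) by simp
      moreover have "p * a \<le> (p + q) * a" by simp
      ultimately show ?thesis using c(2) unfolding f_def[symmetric] by blast
    next
      case True
      then have nz: "snd \<phi> $ a \<noteq> 0" using ord by (simp add: has_order_def)
      have "fps_subst2 g \<phi> $ (q * a) = (\<Sum>i\<le>q. g $ i $ (q - i) * (fst \<phi> $ a) ^ i * (snd \<phi> $ a) ^ (q - i))"
        by (rule fps_subst2_initial_form[OF ord]) (use q in \<open>auto simp: g\<close>)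
      also have "\<dots> = (\<Sum>i\<le>q. if i = 0 then d q * (snd \<phi> $ a) ^ q else 0)"
        using q(1) by (intro sum.cong refl) (auto simp: g)
      also have "\<dots> = d q * (snd \<phi> $ a) ^ q" by (simp add: sum.delta)
      finally have "fps_subst2 g \<phi> $ (q * a) \<noteq> 0" using nz q(2) by simp
      moreover have "q * a \<le> (p + q) * a" by simp
      ultimately show ?thesis using d(2) unfolding g_def[symmetric] by blast
    qed
  qed
qed

section \<open>The exponent as a maximum of Farey numbers\<close>

lemma INF_order_ratio:
  assumes ord: "has_order \<phi> a" and io: "ideal_order I \<phi> A"
  shows "(INF f\<in>I. ereal_of_enat (fps_ord (fps_subst2 f \<phi>)) / ereal_of_enat (param_ord \<phi>)) =
    ereal (real A / real a)"
proof -
  have "0 < a" using ord by (simp add: has_order_def)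
  have p: "ereal_of_enat (param_ord \<phi>) = ereal (real a)"
    by (simp add: param_ord_has_order[OF ord])
  have e: "ereal (real A / real a) = ereal_of_enat (enat A) / ereal (real a)"
    using \<open>0 < a\<close> by simp
  show ?thesis unfolding p
  proof (rule antisym)
    obtain f where f: "f \<in> I" "fps_subst2 f \<phi> $ A \<noteq> 0" using io by (auto simp: ideal_order_def)
    show "(INF f\<in>I. ereal_of_enat (fps_ord (fps_subst2 f \<phi>)) / ereal (real a)) \<le> ereal (real A / real a)"
      unfolding e using \<open>0 < a\<close>
      by (intro INF_lower2[OF f(1)] ereal_divide_right_mono)
         (simp_all only: ereal_of_enat_le_iff fps_ord_le_enat[OF f(2)], simp)
    have "enat A \<le> fps_ord (fps_subst2 f \<phi>)" if "f \<in> I" for f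
      using io that by (simp add: ideal_order_def enat_le_fps_ord_iff)
    then show "ereal (real A / real a) \<le> (INF f\<in>I. ereal_of_enat (fps_ord (fps_subst2 f \<phi>)) / ereal (real a))"
      unfolding e using \<open>0 < a\<close>
      by (intro INF_greatest ereal_divide_right_mono)
         (simp_all only: ereal_of_enat_le_iff, simp)
  qed
qed

lemma finite_bounded_farey_numbers: "finite {q. farey_number q \<and> 0 \<le> q \<and> q \<le> real k}"
proof (rule finite_subset)
  let ?Z = "{0..int k}"
  let ?E = "of_int ` ?Z \<union> (\<lambda>(N, a, b). of_int N + of_int b / of_int a) ` (?Z \<times> ?Z \<times> ?Z) :: real set"
  show "finite ?E" by simp
  show "{q. farey_number q \<and> 0 \<le> q \<and> q \<le> real k} \<subseteq> ?E"
  proof safe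
    fix q assume q: "farey_number q" "0 \<le> q" "q \<le> real k" "q \<notin> (\<lambda>(N, a, b). of_int N + of_int b / of_int a) ` (?Z \<times> ?Z \<times> ?Z)"
    from q(1) show "q \<in> of_int ` ?Z" unfolding farey_number_def
    proof (elim disjE exE conjE)
      assume "q \<in> \<int>"
      then obtain z where z: "q = of_int z" by (elim Ints_cases)
      then have "0 \<le> z" "z \<le> int k" using q(2,3) by linarith+
      then show ?thesis using z by auto
    next
      fix N a b :: int
      assume *: "0 < b" "b < a" "a < N" "q = of_int N + of_int b / of_int a"
      then have "of_int N \<le> q" by simp
      then have "N \<le> int k" using q(3) by linarith
      then have "(N, a, b) \<in> ?Z \<times> ?Z \<times> ?Z" using * by auto
      then have "q \<in> (\<lambda>(N, a, b). of_int N + of_int b / of_int a) ` (?Z \<times> ?Z \<times> ?Z)"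
        using *(4) by (intro rev_image_eqI[of "(N, a, b)"]) auto
      with q(4) show ?thesis ..
    qed
  qed
qed

theorem theorem1p3:
  fixes I :: "'a::alg_closed_field fps fps set"
  assumes "finite_codim_ideal I"
  shows "\<exists>q. farey_number q \<and> lojasiewicz_exponent I = ereal q"
proof -
  obtain k where k: "\<And>\<phi> a. has_order \<phi> a \<Longrightarrow> \<exists>f\<in>I. \<exists>l\<le>k * a. fps_subst2 f \<phi> $ l \<noteq> 0"
    using finite_codim_ideal_order_bound[OF assms] by metis
  have "ideal I (ring_of_type_algebra :: 'a fps fps ring)"
    using assms by (simp add: finite_codim_ideal_def Let_def)
  then interpret ideal I "ring_of_type_algebra :: 'a fps fps ring" .
  have add: "f + g \<in> I" if "f \<in> I" "g \<in> I" for f g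
    using additive_subgroup.a_closed[OF is_additive_subgroup that] by (simp add: ring_of_type_algebra_def)
  have fin: "\<exists>f\<in>I. \<exists>l. fps_subst2 f \<phi> $ l \<noteq> 0" if "\<phi> \<in> parametrizations" for \<phi>
    using has_order_exists[OF that] k by metis
  have bound: "real A / real a \<le> real k" if ord: "has_order \<phi> a" and io: "ideal_order I \<phi> A" for \<phi> a A
  proof -
    have "0 < a" using ord by (simp add: has_order_def)
    obtain f l where "f \<in> I" "l \<le> k * a" "fps_subst2 f \<phi> $ l \<noteq> 0" using k[OF ord] by blast
    then have "A \<le> k * a" using io unfolding ideal_order_def by (meson not_le order_trans)
    then have "real A \<le> real (k * a)" by (rule of_nat_mono)
    then show ?thesis using \<open>0 < a\<close> by (simp add: field_simps)
  qed
  define ratio where "ratio \<phi> = (INF f\<in>I. ereal_of_enat (fps_ord (fps_subst2 f \<phi>)) / ereal_of_enat (param_ord \<phi>))" for \<phi>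
  define V where "V = {q. farey_number q \<and> 0 \<le> q \<and> q \<le> real k \<and> (\<exists>\<psi>\<in>parametrizations. ratio \<psi> = ereal q)}"
  have "finite V"
    by (rule finite_subset[OF _ finite_bounded_farey_numbers[of k]]) (auto simp: V_def)
  have dominated: "\<exists>q\<in>V. ratio \<phi> \<le> ereal q" if par: "\<phi> \<in> parametrizations" for \<phi>
  proof -
    obtain a where a: "has_order \<phi> a" using has_order_exists[OF par] .
    obtain A where A: "ideal_order I \<phi> A" using fin[OF par] ideal_order_exists by metis
    obtain \<psi> b B where \<psi>: "has_order \<psi> b" "ideal_order I \<psi> B"
      "farey_number (real B / real b)" "real A / real a \<le> real B / real b"
      using farey_improvement[OF infinite_UNIV_alg_closed_field add fin a A] by blast
    have "ratio \<psi> = ereal (real B / real b)" "ratio \<phi> = ereal (real A / real a)"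
      unfolding ratio_def using INF_order_ratio \<psi>(1,2) a A by blast+
    moreover have "real B / real b \<in> V"
      unfolding V_def using \<psi>(3) bound[OF \<psi>(1,2)] has_order_parametrization[OF \<psi>(1)] calculation(1)
      by (intro CollectI conjI bexI[of _ \<psi>]) auto
    ultimately show ?thesis using \<psi>(4) by (intro bexI[of _ "real B / real b"]) auto
  qed
  have "(fps_X, 0) \<in> (parametrizations :: ('a fps \<times> 'a fps) set)"
    by (auto simp: parametrizations_def)
  then have "V \<noteq> {}" using dominated by blast
  have "Max V \<in> V" using \<open>finite V\<close> \<open>V \<noteq> {}\<close> by (rule Max_in)
  moreover have "(SUP \<phi>\<in>parametrizations. ratio \<phi>) = ereal (Max V)"
  proof (rule antisym)
    show "(SUP \<phi>\<in>parametrizations. ratio \<phi>) \<le> ereal (Max V)"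
    proof (rule SUP_least)
      fix \<phi> :: "'a fps \<times> 'a fps" assume "\<phi> \<in> parametrizations"
      then obtain q where "q \<in> V" "ratio \<phi> \<le> ereal q" using dominated by blast
      then show "ratio \<phi> \<le> ereal (Max V)"
        using Max_ge[OF \<open>finite V\<close>, of q] by (meson ereal_less_eq(3) order_trans)
    qed
    obtain \<psi> where "\<psi> \<in> parametrizations" "ratio \<psi> = ereal (Max V)"
      using \<open>Max V \<in> V\<close> by (auto simp: V_def)
    then show "ereal (Max V) \<le> (SUP \<phi>\<in>parametrizations. ratio \<phi>)" by (metis SUP_upper)
  qed
  ultimately show ?thesis
    unfolding lojasiewicz_exponent_def ratio_def V_def by blast
qed

end
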